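(* Consider the generalized equation $0\in\Phi x=Fx+Tx$ under the standing assumptions (A1)--(A4) of the context, and assume $L\rho<1$. Let $\hat L>L$ be such that $\hat L\rho<1$, and let $\bar\beta:=\frac{\lambda(4-\hat L\lambda)-4\rho}{4(1-\rho\hat L)}$ and $\Lambda:=\frac{\hat L-L}{L\hat L}$. Let $\{(x^k,u^k)\}$ be generated by the VFOSA$_-$ iteration (see context) using an estimator $\widetilde F^k$ of $Fx^k$ satisfying the $\mathbf{VR}(\Delta_k;\kappa_k,\Theta_k,\sigma_k)$ property (see context). Assume that $$2\rho\le\lambda<\tfrac{2(1+\sqrt{1-\hat L\rho})}{\hat L},\quad 0<\mu<\tfrac23,\quad r\ge 2+\tfrac1\mu,\quad \nu:=\tfrac\mu2,\quad 0<\beta<\tfrac{(2-\mu)\bar\beta}{2+\mu},\quad t_k:=\mu(k+r),\quad \eta_k:=\tfrac{2\beta(t_k-1)}{t_k-\nu},$$ and that there are parameters $\Gamma_k$ and constants $\underline\Theta>0$, $\underline\Gamma>0$ such that for all $k\ge0$: $$\kappa_k\ge 1-\frac{\Gamma_{k-1}t_{k-2}(t_{k-2}-1)}{\Gamma_kt_{k-1}(t_{k-1}-1)}+\frac{5\beta}{\mu\Gamma_k},\qquad \Gamma_k\ge\underline\Gamma,\qquad \Theta_k\ge\underline\Theta,\qquad \Gamma_k\Theta_k\le\Lambda.$$ Assume also that $B_\infty:=\frac\Lambda\beta\sum_{k=0}^\infty t_{k-1}(t_{k-1}-1)\frac{\sigma_k^2}{\Theta_k}<+\infty$. Let $\xi^k:=\frac1\lambda(u^k-x^k)\in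 Tx^k$. Then, almost surely, $$\sum_{k=0}^\infty(k+1)\|Fx^k+\xi^k\|^2<+\infty,\qquad \sum_{k=0}^\infty(k+1)^2\|\widetilde F^k-Fx^k\|^2<+\infty,$$ $$\sum_{k=0}^\infty(k+1)\|u^{k+1}-u^k\|^2<+\infty,\qquad \sum_{k=0}^\infty(k+1)\|x^{k+1}-x^k\|^2<+\infty,$$ and, almost surely, $$\lim_{k\to\infty}k^2\|x^{k+1}-x^k\|^2=0,\qquad \lim_{k\to\infty}k^2\|Fx^k+\xi^k\|^2=0.$$ Moreover, $\{u^k\}$ almost surely converges to a $\mathrm{zer}(S_\lambda)$-valued random variable $u^\star$. Consequently, $\{x^k\}$ also almost surely converges to $x^\star:=J_{\lambda T}u^\star\in\mathrm{zer}(\Phi)$.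
   Context: Problem: $F:\mathbb{R}^p\to\mathbb{R}^p$ is single-valued, $T:\mathbb{R}^p\rightrightarrows2^{\mathbb{R}^p}$ is possibly multi-valued, $\Phi:=F+T$, $\mathrm{dom}(\Phi)=\{x:\Phi x\ne\emptyset\}$, $\mathrm{zer}(\Phi):=\{x:0\in\Phi x\}$. There are two settings: the finite-sum setting $Fx=\frac1n\sum_{i=1}^nF_ix$, and the expectation setting $Fx=\mathbb{E}_\xi[\mathbf F(x,\xi)]$ for a random variable $\xi$. (In the finite-sum setting, $\mathbf F(x,\xi)$ means $F_ix$ with $i$ uniform on $\{1,\dots,n\}$.) Standing assumptions. (A1) $\mathrm{zer}(\Phi)\neq\emptyset$. (A2) In the expectation setting there is $\sigma\ge0$ with $\mathbb{E}_\xi[\|\mathbf F(x,\xi)-Fx\|^2]\le\sigma^2$ for all $x\in\mathrm{dom}(F)$. (A3) $T$ is maximally $\rho$-co-hypomonotone for some $\rho\ge0$: $\langle u-v,x-y\rangle\ge-\rho\|u-v\|^2$ for all $(x,u),(y,v)$ in the graph of $T$, and the graph is not properly contained in that of another such operator. (A4) There is $L>0$ such that for all $x,y\in\mathrm{dom}(F)$: in the finite-sum setting, $\langle Fx-Fy,x-y\rangle\ge\frac1{nL}\sum_{i=1}^n\|F_ix-F_iy\|^2$; in the expectation setting, $\langle Fx-Fy,x-y\rangle\ge\frac1L\mathbb{E}_\xi[\|\mathbf F(x,\xi)-\mathbf F(y,\xi)\|^2]$. Operators: for $\lambda>0$, $J_{\lambda T}u:=\{w:u\in w+\lambda Tw\}$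 is the resolvent of $\lambda T$, and $S_\lambda u:=F(J_{\lambda T}u)+\frac1\lambda(u-J_{\lambda T}u)$ is the backward-forward splitting residual; $\mathrm{zer}(S_\lambda)=\{u:S_\lambda u=0\}$. VFOSA$_-$ iteration: take $x^0\in\mathrm{dom}(\Phi)$, $\xi^0\in Tx^0$, $u^0:=x^0+\lambda\xi^0$, $s^0:=u^0$; for $k\ge0$: $x^k:=J_{\lambda T}u^k$; construct a stochastic estimator $\widetilde F^k$ of $Fx^k$; $v^k:=\frac{t_k-1}{t_k}u^k+\frac1{t_k}s^k$; $u^{k+1}:=v^k-\eta_k\big(\widetilde F^k+\frac1\lambda(u^k-x^k)\big)$; $s^{k+1}:=s^k+\nu(u^{k+1}-v^k)$. The formula $t_k=\mu(k+r)$ is used for all integers $k\ge-2$, and $\Gamma_{-1}>0$ as well. $\mathcal F_k$ is the $\sigma$-algebra generated by all the randomness of the algorithm up to the current iterates with index at most $k$ (the samples drawn at iteration $k$ to build $\widetilde F^k$ are not included), and $\mathbb{E}_k[\cdot]=\mathbb{E}[\cdot\mid\mathcal F_k]$. $\mathbf{VR}(\Delta_k;\kappa_k,\Theta_k,\sigma_k)$ property: there are parameters $\kappa_k\in(0,1]$, $\Theta_k\ge0$, $\sigma_k\ge0$ and random quantities $\Delta_k\ge0$ such that almost surely for all $k\ge0$: $\mathbb{E}_k[\|\widetilde F^k-Fx^k\|^2]\le\mathbb{E}_k[\Delta_k]$ and $\mathbb{E}_k[\Delta_k]\le(1-\kappa_k)\Delta_{k-1}+\Theta_k\bar{\mathcal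 E}_k+\sigma_k^2$, where $\bar{\mathcal E}_k:=\mathbb{E}_\xi[\|\mathbf F(x^k,\xi)-\mathbf F(x^{k-1},\xi)\|^2]$ (i.e. $\frac1n\sum_i\|F_ix^k-F_ix^{k-1}\|^2$ in the finite-sum setting), $x^{-1}:=x^0$, $\Delta_{-1}:=0$. *)

theory Defs
  imports "HOL-Probability.Probability"
begin

section \<open>Multi-valued operators\<close>

definition gra :: "('a \<Rightarrow> 'b set) \<Rightarrow> ('a \<times> 'b) set" where
  "gra T = {(x, u). u \<in> T x}"

definition dom_op :: "('a \<Rightarrow> 'b set) \<Rightarrow> 'a set" where
  "dom_op A = {x. A x \<noteq> {}}"

definition zer :: "('a \<Rightarrow> 'b::zero set) \<Rightarrow> 'a set" where
  "zer A = {x. 0 \<in> A x}"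

definition sum_op :: "('a \<Rightarrow> 'b::plus) \<Rightarrow> ('a \<Rightarrow> 'b set) \<Rightarrow> 'a \<Rightarrow> 'b set" where
  "sum_op F T x = {F x + v | v. v \<in> T x}"

definition co_hypomonotone :: "real \<Rightarrow> ('a::real_inner \<Rightarrow> 'a set) \<Rightarrow> bool" where
  "co_hypomonotone \<rho> T \<longleftrightarrow>
     (\<forall>x u y v. (x, u) \<in> gra T \<longrightarrow> (y, v) \<in> gra T \<longrightarrow>
        (u - v) \<bullet> (x - y) \<ge> - \<rho> * (norm (u - v))\<^sup>2)"

definition maximally_co_hypomonotone :: "real \<Rightarrow> ('a::real_inner \<Rightarrow> 'a set) \<Rightarrow> bool" where
  "maximally_co_hypomonotone \<rho> T \<longleftrightarrow>
     co_hypomonotone \<rho> T \<and> (\<forall>T'. co_hypomonotone \<rho> T' \<longrightarrow> \<not> gra T \<subset> gra T')"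

text \<open>The resolvent and the backward-forward splitting residual are kept set-valued: that they
  are single-valued is a consequence of co-hypomonotonicity, not part of the definition.\<close>

definition resolvent :: "real \<Rightarrow> ('a::real_vector \<Rightarrow> 'a set) \<Rightarrow> 'a \<Rightarrow> 'a set" where
  "resolvent lam T u = {w. \<exists>\<zeta>\<in>T w. u = w + lam *\<^sub>R \<zeta>}"

definition bf_residual ::
  "('a::real_vector \<Rightarrow> 'a) \<Rightarrow> ('a \<Rightarrow> 'a set) \<Rightarrow> real \<Rightarrow> 'a \<Rightarrow> 'a set" where
  "bf_residual F T lam u = {F w + (1 / lam) *\<^sub>R (u - w) | w. w \<in> resolvent lam T u}"


section \<open>The finite-sum and the expectation setting\<close>

text \<open>\<open>Finite_Sum n G\<close> stands for the components \<open>G 1, \<dots>, G n\<close>; in \<open>Expectation Q G\<close> the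
  measure \<open>Q\<close> is the distribution of the random variable \<open>\<xi>\<close> and \<open>G x z\<close> is the stochastic
  operator at \<open>x\<close> for the realisation \<open>z\<close> of \<open>\<xi>\<close>.\<close>

datatype ('a, 'b) setting =
    Finite_Sum nat "nat \<Rightarrow> 'a \<Rightarrow> 'a"
  | Expectation "'b measure" "'a \<Rightarrow> 'b \<Rightarrow> 'a"

fun well_posed :: "('a::euclidean_space, 'b) setting \<Rightarrow> bool" where
  "well_posed (Finite_Sum n G) \<longleftrightarrow> n \<ge> 1"
| "well_posed (Expectation Q G) \<longleftrightarrow> prob_space Q \<and> (\<forall>x. integrable Q (G x))"

fun mean_op :: "('a::euclidean_space, 'b) setting \<Rightarrow> 'a \<Rightarrow> 'a" where
  "mean_op (Finite_Sum n G) x = (1 / real n) *\<^sub>R (\<Sum>i=1..n. G i x)"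
| "mean_op (Expectation Q G) x = (\<integral>z. G x z \<partial>Q)"

fun mean_sq_diff :: "('a::euclidean_space, 'b) setting \<Rightarrow> 'a \<Rightarrow> 'a \<Rightarrow> real" where
  "mean_sq_diff (Finite_Sum n G) x y = (1 / real n) * (\<Sum>i=1..n. (norm (G i x - G i y))\<^sup>2)"
| "mean_sq_diff (Expectation Q G) x y = (\<integral>z. (norm (G x z - G y z))\<^sup>2 \<partial>Q)"

text \<open>The variance bound is imposed in the expectation setting only. Its integrability clause makes
  the Bochner integral the true second moment (a non-integrable function has integral 0), and it
  also yields integrability in the expectation case of \<^const>\<open>mean_sq_diff\<close>.\<close>

fun bounded_variance :: "('a::euclidean_space, 'b) setting \<Rightarrow> bool" where
  "bounded_variance (Finite_Sum n G) \<longleftrightarrow> True"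
| "bounded_variance (Expectation Q G) \<longleftrightarrow>
     (\<exists>\<sigma>\<ge>0. \<forall>x. integrable Q (\<lambda>z. (norm (G x z - mean_op (Expectation Q G) x))\<^sup>2) \<and>
        (\<integral>z. (norm (G x z - mean_op (Expectation Q G) x))\<^sup>2 \<partial>Q) \<le> \<sigma>\<^sup>2)"

definition co_coercive_in_mean :: "real \<Rightarrow> ('a::euclidean_space, 'b) setting \<Rightarrow> bool" where
  "co_coercive_in_mean L S \<longleftrightarrow>
     (\<forall>x y. (mean_op S x - mean_op S y) \<bullet> (x - y) \<ge> (1 / L) * mean_sq_diff S x y)"


section \<open>The VFOSA iteration and its estimators\<close>

text \<open>One trajectory of the method. The values \<open>Ft k\<close> of the estimator are arbitrary here; their
  quality is controlled by the variance-reduction property below.\<close>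

definition VFOSA_minus ::
  "('a::euclidean_space \<Rightarrow> 'a) \<Rightarrow> ('a \<Rightarrow> 'a set) \<Rightarrow> real \<Rightarrow> real \<Rightarrow> (int \<Rightarrow> real) \<Rightarrow> (nat \<Rightarrow> real) \<Rightarrow>
   'a \<Rightarrow> 'a \<Rightarrow> (nat \<Rightarrow> 'a) \<Rightarrow> (nat \<Rightarrow> 'a) \<Rightarrow> (nat \<Rightarrow> 'a) \<Rightarrow> (nat \<Rightarrow> 'a) \<Rightarrow> (nat \<Rightarrow> 'a) \<Rightarrow> bool" where
  "VFOSA_minus F T lam \<nu> t \<eta> x0 \<xi>0 Ft x u v s \<longleftrightarrow>
     x0 \<in> dom_op (sum_op F T) \<and> \<xi>0 \<in> T x0 \<and>
     u 0 = x0 + lam *\<^sub>R \<xi>0 \<and> s 0 = u 0 \<and>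
     (\<forall>k. x k \<in> resolvent lam T (u k) \<and>
          v k = ((t (int k) - 1) / t (int k)) *\<^sub>R u k + (1 / t (int k)) *\<^sub>R s k \<and>
          u (Suc k) = v k - \<eta> k *\<^sub>R (Ft k + (1 / lam) *\<^sub>R (u k - x k)) \<and>
          s (Suc k) = s k + \<nu> *\<^sub>R (u (Suc k) - v k))"

text \<open>The filtration is an arbitrary one for which the iterates of index \<open>k\<close> are known at time \<open>k\<close>
  and what is drawn during iteration \<open>k\<close> is known at time \<open>k + 1\<close>; the \<open>\<sigma>\<close>-algebras generated by the
  randomness of the algorithm are an instance.\<close>

definition algorithm_filtration ::
  "'w measure \<Rightarrow> (nat \<Rightarrow> 'w measure) \<Rightarrow> (nat \<Rightarrow> 'w \<Rightarrow> 'a::euclidean_space) \<Rightarrow> (nat \<Rightarrow> 'w \<Rightarrow> 'a) \<Rightarrow>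
   (nat \<Rightarrow> 'w \<Rightarrow> 'a) \<Rightarrow> (nat \<Rightarrow> 'w \<Rightarrow> real) \<Rightarrow> bool" where
  "algorithm_filtration M Fil x u Ft \<Delta> \<longleftrightarrow>
     filtration (space M) Fil \<and>
     (\<forall>k. subalgebra M (Fil k) \<and>
          x k \<in> borel_measurable (Fil k) \<and> u k \<in> borel_measurable (Fil k) \<and>
          Ft k \<in> borel_measurable (Fil (Suc k)) \<and> \<Delta> k \<in> borel_measurable (Fil (Suc k)))"

text \<open>The conditional expectations are those of nonnegative functions, with values in
  \<open>[0, \<infinity>]\<close>, so no integrability is presupposed. For \<open>k = 0\<close>, the truncated \<open>x (k - 1)\<close> is \<open>x 0\<close>,
  which is the convention for the iterate of index \<open>-1\<close>; the conditional encodes that \<open>\<Delta>\<close> vanishes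
  at index \<open>-1\<close>.\<close>

definition VR_property ::
  "'w measure \<Rightarrow> (nat \<Rightarrow> 'w measure) \<Rightarrow> ('a::euclidean_space, 'b) setting \<Rightarrow>
   (nat \<Rightarrow> 'w \<Rightarrow> 'a) \<Rightarrow> (nat \<Rightarrow> 'w \<Rightarrow> 'a) \<Rightarrow>
   (nat \<Rightarrow> 'w \<Rightarrow> real) \<Rightarrow> (nat \<Rightarrow> real) \<Rightarrow> (nat \<Rightarrow> real) \<Rightarrow> (nat \<Rightarrow> real) \<Rightarrow> bool" where
  "VR_property M Fil S x Ft \<Delta> \<kappa> \<Theta> \<sigma> \<longleftrightarrow>
     (\<forall>k. 0 < \<kappa> k \<and> \<kappa> k \<le> 1 \<and> 0 \<le> \<Theta> k \<and> 0 \<le> \<sigma> k) \<and>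
     (\<forall>k. \<forall>\<omega>\<in>space M. 0 \<le> \<Delta> k \<omega>) \<and>
     (AE \<omega> in M. \<forall>k.
        nn_cond_exp M (Fil k) (\<lambda>\<omega>. ennreal ((norm (Ft k \<omega> - mean_op S (x k \<omega>)))\<^sup>2)) \<omega>
          \<le> nn_cond_exp M (Fil k) (\<lambda>\<omega>. ennreal (\<Delta> k \<omega>)) \<omega> \<and>
        nn_cond_exp M (Fil k) (\<lambda>\<omega>. ennreal (\<Delta> k \<omega>)) \<omega>
          \<le> ennreal ((1 - \<kappa> k) * (if k = 0 then 0 else \<Delta> (k - 1) \<omega>)
                     + \<Theta> k * mean_sq_diff S (x k \<omega>) (x (k - 1) \<omega>) + (\<sigma> k)\<^sup>2))"

end

theory Submission
  imports Defs
begin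

text \<open>
  The residual \<open>S u = F (J u) + (u - J u) / lam\<close> of the backward-forward splitting, with \<open>J\<close> the resolvent of
  \<open>lam T\<close>, is cocoercive (\<open>residual_cocoercive\<close>). Its zeros correspond to the zeros of \<open>F + T\<close>, and the method is
  an inexact accelerated fixed-point iteration for it: with the anchor \<open>s\<close>, the gap \<open>w = s - u\<close> and the
  estimation error \<open>e\<close>,
  \<open>u' - u = w / t - \<eta> (S + e)\<close> and \<open>w' = (1 - 1/t) w + (1 - \<nu>) \<eta> (S + e)\<close>.

  The Lyapunov function is
  \<open>V\<^sub>k = \<beta> t\<^sub>k\<^sub>-\<^sub>1 (t\<^sub>k\<^sub>-\<^sub>1 - 1) \<parallel>S\<parallel>\<^sup>2 - t\<^sub>k\<^sub>-\<^sub>1 \<langle>S, w\<rangle> + (1 - \<mu>) / (\<mu> \<eta>\<^sub>k) \<parallel>s - z\<parallel>\<^sup>2\<close>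
  for a zero \<open>z\<close>. It dominates a multiple of \<open>t\<^sub>k\<^sub>-\<^sub>1\<^sup>2 \<parallel>S\<parallel>\<^sup>2 + \<parallel>s - z\<parallel>\<^sup>2\<close> (\<open>potential_coercive\<close>), and on every
  realisation (\<open>potential_step\<close>) it decreases by a multiple of \<open>t \<parallel>S\<parallel>\<^sup>2\<close> and by
  \<open>\<Lambda> t (t - 1)\<close> times the mean square difference of consecutive iterates, up to a summable relative growth
  and the error charge \<open>(4 \<beta> / \<mu>) t (t - 1) \<parallel>e\<parallel>\<^sup>2\<close>.

  Probability enters at one point only. Integrating this inequality and the variance recursion shows
  that the expectations of \<open>t (t - 1) \<parallel>e\<parallel>\<^sup>2\<close> are summable (\<open>variance_reduction_errors_summable\<close>), hence so are the
  random variables themselves, almost surely.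

  On a realisation with summable errors the rest is deterministic. The Lyapunov function converges
  and \<open>t \<parallel>S\<parallel>\<^sup>2\<close> is summable; the contraction of the gap gives \<open>w \<longlonglongrightarrow> 0\<close> and summability of
  \<open>\<parallel>w\<parallel>\<^sup>2 / t\<close>, whence the summability of the increments. The first two terms of the Lyapunov function
  converge on their own (\<open>coupling_converges\<close>), so \<open>k\<^sup>2 \<parallel>S\<parallel>\<^sup>2\<close> has a limit, which must be zero. What remains of
  the Lyapunov function then shows that the distance to every zero converges, and Opial's argument
  together with closedness of the graph of \<open>T\<close> identifies the limit. The iterates \<open>x\<close> inherit everything
  because the resolvent is nonexpansive.
\<close>

section \<open>Resolvents of co-hypomonotone operators\<close>

lemma resolvent_selection:
  assumes "lam > 0" "w \<in> resolvent lam T u"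
  shows "(1 / lam) *\<^sub>R (u - w) \<in> T w"
  using assms by (auto simp: resolvent_def)

lemma co_hypomonotoneD:
  assumes "co_hypomonotone \<rho> T" "\<zeta> \<in> T x" "\<zeta>' \<in> T x'"
  shows "- \<rho> * (norm (\<zeta> - \<zeta>'))\<^sup>2 \<le> (\<zeta> - \<zeta>') \<bullet> (x - x')"
  using assms by (auto simp: co_hypomonotone_def gra_def)

text \<open>Expanding \<open>\<parallel>u - u'\<parallel>\<^sup>2\<close> in \<open>x - x'\<close> and the difference \<open>z\<close> of the selections leaves
  \<open>2 lam \<langle>z, x - x'\<rangle> + lam\<^sup>2 \<parallel>z\<parallel>\<^sup>2\<close>, and \<open>2 \<rho> \<le> lam\<close> is exactly what makes this nonnegative in spite of
  the negative curvature \<open>- \<rho> \<parallel>z\<parallel>\<^sup>2\<close>. Single-valuedness of the resolvent is the case \<open>u = u'\<close>.\<close>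

lemma resolvent_nonexpansive:
  fixes x x' u u' :: "'a::real_inner"
  assumes T: "co_hypomonotone \<rho> T" and lam: "lam > 0" "2 * \<rho> \<le> lam"
    and x: "x \<in> resolvent lam T u" "x' \<in> resolvent lam T u'"
  shows "norm (x - x') \<le> norm (u - u')"
proof -
  define z where "z = (1 / lam) *\<^sub>R (u - x) - (1 / lam) *\<^sub>R (u' - x')"
  have mono: "- \<rho> * (norm z)\<^sup>2 \<le> z \<bullet> (x - x')"
    unfolding z_def using co_hypomonotoneD[OF T] resolvent_selection[OF lam(1)] x by blast
  have du: "u - u' = (x - x') + lam *\<^sub>R z"
    using lam(1) by (simp add: z_def algebra_simps)
  have "(norm (u - u'))\<^sup>2 = (norm (x - x'))\<^sup>2 + 2 * lam * (z \<bullet> (x - x')) + lam\<^sup>2 * (norm z)\<^sup>2"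
    unfolding du power2_norm_eq_inner
    by (simp add: inner_add_left inner_add_right inner_commute power2_eq_square algebra_simps)
  moreover have "2 * lam * (- \<rho> * (norm z)\<^sup>2) \<le> 2 * lam * (z \<bullet> (x - x'))"
    using mono lam(1) by (intro mult_left_mono) auto
  moreover have "lam * (2 * \<rho>) * (norm z)\<^sup>2 \<le> lam * lam * (norm z)\<^sup>2"
    using lam by (intro mult_right_mono mult_left_mono) auto
  moreover have "2 * lam * (- \<rho> * (norm z)\<^sup>2) = - (lam * (2 * \<rho>) * (norm z)\<^sup>2)"
    "lam\<^sup>2 * (norm z)\<^sup>2 = lam * lam * (norm z)\<^sup>2"
    by (simp_all add: power2_eq_square)
  ultimately have "(norm (x - x'))\<^sup>2 \<le> (norm (u - u'))\<^sup>2"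
    by linarith
  then show ?thesis by (rule power2_le_imp_le) simp
qed

lemma resolvent_unique:
  fixes x x' u :: "'a::real_inner"
  assumes "co_hypomonotone \<rho> T" "lam > 0" "2 * \<rho> \<le> lam"
    and "x \<in> resolvent lam T u" "x' \<in> resolvent lam T u"
  shows "x = x'"
  using resolvent_nonexpansive[OF assms] by simp

text \<open>A limit of graph points satisfies the defining inequality against every graph point, so it could
  be added to the graph; by maximality it is already there.\<close>

lemma maximally_co_hypomonotone_closed:
  fixes x \<zeta> :: "nat \<Rightarrow> 'a::real_inner"
  assumes T: "maximally_co_hypomonotone \<rho> T"
    and mem: "\<And>k. \<zeta> k \<in> T (x k)" and lim: "x \<longlonglongrightarrow> xl" "\<zeta> \<longlonglongrightarrow> \<zeta>l"
  shows "\<zeta>l \<in> T xl"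
proof (rule ccontr)
  assume new: "\<zeta>l \<notin> T xl"
  define T' where "T' = (\<lambda>y. if y = xl then insert \<zeta>l (T xl) else T y)"
  have mono: "co_hypomonotone \<rho> T"
    using T by (simp add: maximally_co_hypomonotone_def)
  have limit_pair: "- \<rho> * (norm (\<zeta>l - v))\<^sup>2 \<le> (\<zeta>l - v) \<bullet> (xl - y)" if "v \<in> T y" for y v
  proof (rule LIMSEQ_le)
    show "(\<lambda>k. - \<rho> * (norm (\<zeta> k - v))\<^sup>2) \<longlonglongrightarrow> - \<rho> * (norm (\<zeta>l - v))\<^sup>2"
      by (intro tendsto_intros lim)
    show "(\<lambda>k. (\<zeta> k - v) \<bullet> (x k - y)) \<longlonglongrightarrow> (\<zeta>l - v) \<bullet> (xl - y)"
      by (intro tendsto_intros lim)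
    show "\<exists>N. \<forall>k\<ge>N. - \<rho> * (norm (\<zeta> k - v))\<^sup>2 \<le> (\<zeta> k - v) \<bullet> (x k - y)"
      using co_hypomonotoneD[OF mono mem that] by blast
  qed
  have swap: "- \<rho> * (norm (v - \<zeta>l))\<^sup>2 \<le> (v - \<zeta>l) \<bullet> (y - xl)" if "v \<in> T y" for y v
    using limit_pair[OF that] by (simp add: norm_minus_commute inner_diff_left inner_diff_right)
  have gra': "gra T' = insert (xl, \<zeta>l) (gra T)"
    by (auto simp: gra_def T'_def split: if_splits)
  have "co_hypomonotone \<rho> T'"
    unfolding co_hypomonotone_def gra' 
    using limit_pair swap mono by (auto simp: gra_def co_hypomonotone_def)
  moreover have "gra T \<subset> gra T'"
    unfolding gra' using new by (auto simp: gra_def)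
  ultimately show False
    using T by (auto simp: maximally_co_hypomonotone_def)
qed

text \<open>The value of \<open>b\<close> is the largest constant for which the difference of the two sides is a
  positive semidefinite quadratic form in \<open>(f, z)\<close>: its discriminant vanishes for this \<open>b\<close>, so the
  difference is a multiple of a single square.\<close>

lemma residual_quadratic_form:
  fixes f z :: "'a::real_inner"
  assumes M: "M > 0" "M * \<rho> < 1" and lam: "2 * \<rho> \<le> lam"
    and b: "b = (lam * (4 - M * lam) - 4 * \<rho>) / (4 * (1 - \<rho> * M))"
  shows "b * (norm (f + z))\<^sup>2
       \<le> (1 / M) * (norm f)\<^sup>2 + lam * (f \<bullet> z) + (lam - \<rho>) * (norm z)\<^sup>2"
proof -
  have pos: "1 - \<rho> * M > 0" using M by (simp add: mult.commute)
  have key: "4 * b * (1 - \<rho> * M) = lam * (4 - M * lam) - 4 * \<rho>"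
    using pos unfolding b by (simp add: field_simps)
  define p where "p = 1 / M - b"
  have pM: "1 = M * (p + b)" using M(1) by (simp add: p_def)
  have square: "4 * (1 - \<rho> * M) * (M * p) = (2 - M * lam)\<^sup>2"
  proof -
    have "M * p = 1 - M * b" using pM by (simp add: algebra_simps)
    then have "4 * (1 - \<rho> * M) * (M * p) = 4 * (1 - \<rho> * M) * (1 - M * b)"
      by simp
    also have "\<dots> = 4 * (1 - \<rho> * M) - M * (4 * b * (1 - \<rho> * M))"
      by (simp add: algebra_simps)
    finally have "4 * (1 - \<rho> * M) * (M * p) = 4 * (1 - \<rho> * M) - M * (4 * b * (1 - \<rho> * M))" .
    then show ?thesis unfolding key by (simp add: power2_eq_square algebra_simps)
  qed
  have "0 \<le> 4 * (1 - \<rho> * M) * M * p" using square by (simp add: mult.assoc)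
  then have p0: "p \<ge> 0"
    using pos M(1) by (metis mult_pos_pos zero_le_mult_iff zero_less_numeral not_le)
  \<comment> \<open>The discriminant of the form, with leading coefficient \<open>p\<close>, is zero.\<close>
  have disc: "4 * p * (lam - \<rho> - b) = (lam - 2 * b)\<^sup>2"
  proof -
    have "M * (4 * p * (lam - \<rho> - b)) = 4 * (1 - M * b) * (lam - \<rho> - b)"
    proof -
      have "M * p = 1 - M * b" using pM by (simp add: algebra_simps)
      then show ?thesis by (metis mult.assoc mult.left_commute)
    qed
    also have "\<dots> = M * (lam - 2 * b)\<^sup>2"
      using key by (simp add: power2_eq_square algebra_simps)
    finally show ?thesis using M(1) by simp
  qed
  have "0 \<le> p * (norm f)\<^sup>2 + (lam - 2 * b) * (f \<bullet> z) + (lam - \<rho> - b) * (norm z)\<^sup>2"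
  proof (cases "p = 0")
    case True
    then have "lam = 2 * b" using disc by simp
    then show ?thesis using True lam by simp
  next
    case False
    have "4 * p * (p * (norm f)\<^sup>2 + (lam - 2 * b) * (f \<bullet> z) + (lam - \<rho> - b) * (norm z)\<^sup>2)
        = 4 * p * p * (norm f)\<^sup>2 + 4 * p * (lam - 2 * b) * (f \<bullet> z)
          + (4 * p * (lam - \<rho> - b)) * (norm z)\<^sup>2"
      by (simp add: algebra_simps)
    also have "\<dots> = (norm ((2 * p) *\<^sub>R f + (lam - 2 * b) *\<^sub>R z))\<^sup>2"
      unfolding disc power2_norm_eq_inner
      by (simp add: inner_add_left inner_add_right inner_commute power2_eq_square algebra_simps)
    finally have "0 \<le> 4 * p * (p * (norm f)\<^sup>2 + (lam - 2 * b) * (f \<bullet> z) + (lam - \<rho> - b) * (norm z)\<^sup>2)"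
      by simp
    then show ?thesis using p0 False by (simp add: zero_le_mult_iff)
  qed
  moreover have "(norm (f + z))\<^sup>2 = (norm f)\<^sup>2 + 2 * (f \<bullet> z) + (norm z)\<^sup>2"
    unfolding power2_norm_eq_inner by (simp add: inner_add_left inner_add_right inner_commute)
  ultimately show ?thesis by (simp add: p_def algebra_simps)
qed

section \<open>Mean operators and cocoercivity of the residual\<close>

lemma mean_sq_diff_nonneg: "0 \<le> mean_sq_diff S x y"
  by (cases S) (auto intro!: sum_nonneg divide_nonneg_nonneg)

lemma mean_sq_diff_refl: "mean_sq_diff S x x = 0"
  by (cases S) auto

text \<open>The Bochner integral in the mean square difference is meaningful because the difference of two
  realisations is controlled by their two deviations from the means and the distance of the means.\<close>

lemma expectation_sq_diff_integrable:
  assumes "well_posed (Expectation Q G)" "bounded_variance (Expectation Q G)"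
  shows "integrable Q (\<lambda>z. (norm (G x z - G y z))\<^sup>2)"
proof (rule Bochner_Integration.integrable_bound)
  let ?m = "mean_op (Expectation Q G)"
  interpret prob_space Q using assms by simp
  let ?b = "\<lambda>z. 3 * (norm (G x z - ?m x))\<^sup>2 + 3 * (norm (G y z - ?m y))\<^sup>2 + 3 * (norm (?m x - ?m y))\<^sup>2"
  show "integrable Q ?b"
    using assms(2) by (auto simp del: mean_op.simps)
  show "(\<lambda>z. (norm (G x z - G y z))\<^sup>2) \<in> borel_measurable Q"
  proof -
    have [measurable]: "G x \<in> borel_measurable Q" "G y \<in> borel_measurable Q"
      using assms(1) by (auto intro: borel_measurable_integrable)
    show ?thesis by measurable
  qed
  have "(norm (G x z - G y z))\<^sup>2 \<le> ?b z" for z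
  proof -
    let ?A = "norm (G x z - ?m x)" and ?B = "norm (G y z - ?m y)" and ?C = "norm (?m x - ?m y)"
    have "norm (G x z - G y z) \<le> ?A + ?B + ?C"
      by norm
    then have "(norm (G x z - G y z))\<^sup>2 \<le> (?A + ?B + ?C)\<^sup>2"
      by (intro power_mono) auto
    also have "\<dots> \<le> 3 * ?A\<^sup>2 + 3 * ?B\<^sup>2 + 3 * ?C\<^sup>2"
      using sum_squares_ge_zero[of "?A - ?B" "?B - ?C"] zero_le_power2[of "?A - ?C"]
      by (simp add: power2_eq_square algebra_simps)
    finally show ?thesis .
  qed
  then show "AE z in Q. norm ((norm (G x z - G y z))\<^sup>2) \<le> norm (?b z)"
    by (auto simp del: mean_op.simps)
qed

text \<open>Jensen's inequality for the square, in both settings obtained from the fact that the variance of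
  the difference of the two realisations is nonnegative.\<close>

lemma mean_op_diff_le_mean_sq_diff:
  assumes "well_posed S" "bounded_variance S"
  shows "(norm (mean_op S x - mean_op S y))\<^sup>2 \<le> mean_sq_diff S x y"
proof (cases S)
  case (Finite_Sum n G)
  let ?m = "mean_op S x - mean_op S y" and ?D = "\<lambda>i. G i x - G i y"
  have n: "real n > 0" using assms(1) Finite_Sum by simp
  have m: "(\<Sum>i=1..n. ?D i) = real n *\<^sub>R ?m"
    using n Finite_Sum by (simp add: sum_subtractf algebra_simps)
  have "0 \<le> (\<Sum>i=1..n. (norm (?D i - ?m))\<^sup>2)" by (intro sum_nonneg) simp
  also have "\<dots> = (\<Sum>i=1..n. (norm (?D i))\<^sup>2 - 2 * (?D i \<bullet> ?m) + (norm ?m)\<^sup>2)"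
    by (intro sum.cong refl) (simp add: power2_norm_eq_inner inner_diff_left inner_diff_right inner_commute)
  also have "\<dots> = (\<Sum>i=1..n. (norm (?D i))\<^sup>2) - 2 * ((\<Sum>i=1..n. ?D i) \<bullet> ?m) + real n * (norm ?m)\<^sup>2"
    unfolding inner_sum_left sum_distrib_left by (simp add: sum.distrib sum_subtractf)
  also have "\<dots> = (\<Sum>i=1..n. (norm (?D i))\<^sup>2) - real n * (norm ?m)\<^sup>2"
    unfolding m by (simp add: power2_norm_eq_inner)
  finally show ?thesis using n Finite_Sum by (simp add: field_simps)
next
  case (Expectation Q G)
  interpret prob_space Q using assms Expectation by simp
  let ?m = "mean_op S x - mean_op S y" and ?D = "\<lambda>z. G x z - G y z"
  have int: "integrable Q ?D" using assms(1) Expectation by simp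
  have int2: "integrable Q (\<lambda>z. (norm (?D z))\<^sup>2)"
    using expectation_sq_diff_integrable assms Expectation by blast
  have m: "(\<integral>z. ?D z \<partial>Q) = ?m"
    using assms(1) Expectation by simp
  have "0 \<le> (\<integral>z. (norm (?D z - ?m))\<^sup>2 \<partial>Q)" by simp
  also have "\<dots> = (\<integral>z. (norm (?D z))\<^sup>2 - 2 * (?D z \<bullet> ?m) + (norm ?m)\<^sup>2 \<partial>Q)"
    by (intro Bochner_Integration.integral_cong refl)
       (simp add: power2_norm_eq_inner inner_diff_left inner_diff_right inner_commute)
  also have "\<dots> = (\<integral>z. (norm (?D z))\<^sup>2 \<partial>Q) - 2 * ((\<integral>z. ?D z \<partial>Q) \<bullet> ?m) + (norm ?m)\<^sup>2"
    using int int2 by (simp add: prob_space del: inner_diff_left inner_diff_right)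
  also have "\<dots> = (\<integral>z. (norm (?D z))\<^sup>2 \<partial>Q) - (norm ?m)\<^sup>2"
    unfolding m by (simp add: power2_norm_eq_inner)
  finally show ?thesis using Expectation by simp
qed

lemma mean_op_Lipschitz:
  assumes "well_posed S" "bounded_variance S" "L > 0" "co_coercive_in_mean L S"
  shows "norm (mean_op S x - mean_op S y) \<le> L * norm (x - y)"
proof -
  let ?d = "mean_op S x - mean_op S y"
  have "(1 / L) * (norm ?d)\<^sup>2 \<le> (1 / L) * mean_sq_diff S x y"
    using mean_op_diff_le_mean_sq_diff[OF assms(1,2)] assms(3) by (intro mult_left_mono) auto
  also have "\<dots> \<le> ?d \<bullet> (x - y)"
    using assms(4) by (simp add: co_coercive_in_mean_def)
  also have "\<dots> \<le> norm ?d * norm (x - y)"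
    by (rule norm_cauchy_schwarz)
  finally have "norm ?d * norm ?d \<le> norm ?d * (L * norm (x - y))"
    using assms(3) by (simp add: field_simps power2_eq_square)
  then show ?thesis
    using assms(3) by (cases "norm ?d = 0") (auto simp: mult_le_cancel_left)
qed

lemma mean_op_continuous:
  assumes "well_posed S" "bounded_variance S" "L > 0" "co_coercive_in_mean L S"
  shows "continuous_on A (mean_op S)"
proof -
  have "L-lipschitz_on A (mean_op S)"
    using mean_op_Lipschitz[OF assms] assms(3) by (intro lipschitz_onI) (auto simp: dist_norm)
  then show ?thesis by (rule lipschitz_on_continuous_on)
qed

text \<open>Cocoercivity of the backward-forward residual. The constant \<open>1/L\<close> of \<open>F\<close> is split as
  \<open>(1/L - 1/M) + 1/M\<close>. The second part, together with the co-hypomonotonicity of \<open>T\<close>, gives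
  cocoercivity of the residual. The first part is kept as a multiple of the mean square difference,
  and this surplus is what later pays for the variance recursion of the estimator.\<close>

lemma residual_cocoercive:
  assumes S: "well_posed S" "bounded_variance S" "co_coercive_in_mean L S" and L: "0 < L" "L < M" "M * \<rho> < 1"
    and T: "co_hypomonotone \<rho> T" and lam: "lam > 0" "2 * \<rho> \<le> lam"
    and b: "b = (lam * (4 - M * lam) - 4 * \<rho>) / (4 * (1 - \<rho> * M))"
    and x: "x \<in> resolvent lam T u" "x' \<in> resolvent lam T u'"
    and R: "R = mean_op S x + (1 / lam) *\<^sub>R (u - x)" "R' = mean_op S x' + (1 / lam) *\<^sub>R (u' - x')"
  shows "b * (norm (R - R'))\<^sup>2 + (M - L) / (L * M) * mean_sq_diff S x x' \<le> (R - R') \<bullet> (u - u')"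
proof -
  define z where "z = (1 / lam) *\<^sub>R (u - x) - (1 / lam) *\<^sub>R (u' - x')"
  define f where "f = mean_op S x - mean_op S x'"
  have mono: "- \<rho> * (norm z)\<^sup>2 \<le> z \<bullet> (x - x')"
    unfolding z_def using co_hypomonotoneD[OF T] resolvent_selection[OF lam(1)] x by blast
  have u: "u - u' = (x - x') + lam *\<^sub>R z"
    using lam(1) by (simp add: z_def algebra_simps)
  have RR: "R - R' = f + z" using R by (simp add: f_def z_def)
  let ?E = "mean_sq_diff S x x'"
  have "(1 / L) * ?E \<le> f \<bullet> (x - x')"
    using S(3) by (simp add: f_def co_coercive_in_mean_def)
  moreover have "(1 / M) * (norm f)\<^sup>2 \<le> (1 / M) * ?E"
    unfolding f_def using mean_op_diff_le_mean_sq_diff[OF S(1,2)] L by (intro mult_left_mono) auto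
  moreover have "(M - L) / (L * M) * ?E = (1 / L) * ?E - (1 / M) * ?E"
    using L by (simp add: field_simps)
  moreover have "b * (norm (f + z))\<^sup>2
       \<le> (1 / M) * (norm f)\<^sup>2 + lam * (f \<bullet> z) + (lam - \<rho>) * (norm z)\<^sup>2"
    using L by (intro residual_quadratic_form[OF _ L(3) lam(2) b]) auto
  moreover have "(f + z) \<bullet> (x - x' + lam *\<^sub>R z)
     = f \<bullet> (x - x') + lam * (f \<bullet> z) + z \<bullet> (x - x') + lam * (norm z)\<^sup>2"
    unfolding power2_norm_eq_inner by (simp add: inner_add_left inner_add_right inner_diff_right algebra_simps)
  moreover have "(lam - \<rho>) * (norm z)\<^sup>2 = lam * (norm z)\<^sup>2 + - \<rho> * (norm z)\<^sup>2"
    by (simp add: algebra_simps)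
  ultimately show ?thesis
    unfolding RR u using mono by linarith
qed

section \<open>Real sequences\<close>

lemma almost_monotone_convergent:
  fixes v g :: "nat \<Rightarrow> real"
  assumes low: "\<And>k. l \<le> v k" and step: "\<And>k. v (Suc k) \<le> v k + g k" and g: "summable g"
  shows "convergent v"
proof -
  let ?w = "\<lambda>k. v k - (\<Sum>j<k. g j)"
  obtain K where K: "\<And>k. \<bar>\<Sum>j<k. g j\<bar> \<le> K"
    using convergent_imp_Bseq[OF g[unfolded summable_iff_convergent]] by (auto simp: Bseq_def)
  have "decseq ?w"
    by (rule decseq_SucI) (use step in \<open>simp add: algebra_simps\<close>)
  moreover have "l - K \<le> ?w k" for k
    using low[of k] K[of k] by linarith
  ultimately obtain m where "?w \<longlonglongrightarrow> m"
    using decseq_convergent by blast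
  moreover have "(\<lambda>k. \<Sum>j<k. g j) \<longlonglongrightarrow> suminf g"
    using g by (rule summable_LIMSEQ)
  ultimately have "(\<lambda>k. ?w k + (\<Sum>j<k. g j)) \<longlonglongrightarrow> m + suminf g"
    by (rule tendsto_add)
  then show ?thesis by (auto simp: convergent_def)
qed

lemma summable_decrements:
  fixes v g c :: "nat \<Rightarrow> real"
  assumes "\<And>k. 0 \<le> v k" "\<And>k. 0 \<le> c k" "\<And>k. 0 \<le> g k"
    and step: "\<And>k. v (Suc k) + c k \<le> v k + g k" and g: "summable g"
  shows "summable c"
proof (rule summableI_nonneg_bounded)
  fix n
  have "(\<Sum>k<n. c k) \<le> v 0 - v n + (\<Sum>k<n. g k)"
  proof (induction n)
    case (Suc n)
    then show ?case using step[of n] by simp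
  qed simp
  also have "\<dots> \<le> v 0 + suminf g"
    using assms(1)[of n] sum_le_suminf[OF g, of "{..<n}"] assms(3) by simp
  finally show "(\<Sum>k<n. c k) \<le> v 0 + suminf g" .
qed (use assms in auto)

text \<open>The deterministic form of the Robbins-Siegmund lemma. The factors \<open>1 + q k\<close> have a bounded product,
  so \<open>v\<close> is bounded by some \<open>B\<close> and \<open>q k * v k\<close> can be moved into the summable perturbation.\<close>

lemma almost_supermartingale_sequence:
  fixes v g c q :: "nat \<Rightarrow> real"
  assumes nonneg: "\<And>k. 0 \<le> v k" "\<And>k. 0 \<le> c k" "\<And>k. 0 \<le> g k" "\<And>k. 0 \<le> q k"
    and step: "\<And>k. v (Suc k) + c k \<le> (1 + q k) * v k + g k"
    and q: "summable q" and g: "summable g"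
  shows "convergent v" "summable c"
proof -
  define B where "B = exp (suminf q) * (v 0 + suminf g)"
  have sg: "(\<Sum>j<k. g j) \<le> suminf g" for k
    using sum_le_suminf[OF g] nonneg(3) by blast
  have sq: "(\<Sum>j<k. q j) \<le> suminf q" for k
    using sum_le_suminf[OF q] nonneg(4) by blast
  have "v k \<le> exp (\<Sum>j<k. q j) * (v 0 + (\<Sum>j<k. g j))" for k
  proof (induction k)
    case (Suc k)
    have "v (Suc k) \<le> (1 + q k) * v k + g k"
      using step[of k] nonneg(2)[of k] by linarith
    also have "\<dots> \<le> exp (q k) * v k + exp (\<Sum>j<Suc k. q j) * g k"
    proof (rule add_mono)
      show "(1 + q k) * v k \<le> exp (q k) * v k"
        using nonneg(1) by (intro mult_right_mono) auto
      have "1 \<le> exp (\<Sum>j<Suc k. q j)" using nonneg(4) by (intro one_le_exp_iff[THEN iffD2] sum_nonneg) auto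
      then show "g k \<le> exp (\<Sum>j<Suc k. q j) * g k"
        using mult_right_mono[of 1 _ "g k"] nonneg(3) by fastforce
    qed
    also have "\<dots> \<le> exp (q k) * (exp (\<Sum>j<k. q j) * (v 0 + (\<Sum>j<k. g j))) + exp (\<Sum>j<Suc k. q j) * g k"
      using Suc by (intro add_mono mult_left_mono) auto
    also have "\<dots> = exp (\<Sum>j<Suc k. q j) * (v 0 + (\<Sum>j<Suc k. g j))"
      by (simp add: exp_add algebra_simps)
    finally show ?case .
  qed simp
  also have "\<And>k. exp (\<Sum>j<k. q j) * (v 0 + (\<Sum>j<k. g j)) \<le> B"
    unfolding B_def using sq sg nonneg by (intro mult_mono) (auto intro!: add_nonneg_nonneg sum_nonneg)
  finally have vB: "v k \<le> B" for k .
  have gB: "summable (\<lambda>k. B * q k + g k)"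
    using q g by (intro summable_add summable_mult)
  have step': "v (Suc k) + c k \<le> v k + (B * q k + g k)" for k
  proof -
    have "q k * v k \<le> q k * B" using vB nonneg(4) by (intro mult_left_mono) auto
    then show ?thesis using step[of k] by (simp add: algebra_simps)
  qed
  have "0 \<le> B" using vB[of 0] nonneg(1)[of 0] by linarith
  then have "\<And>k. 0 \<le> B * q k + g k" using nonneg(3,4) by simp
  then show "summable c"
    using summable_decrements[OF nonneg(1,2) _ step' gB] by blast
  have "v (Suc k) \<le> v k + (B * q k + g k)" for k
    using step'[of k] nonneg(2)[of k] by linarith
  from almost_monotone_convergent[OF nonneg(1) this gB] show "convergent v" .
qed

lemma summable_inverse_squares: "summable (\<lambda>k. 1 / (real k + 1)\<^sup>2)"
proof -
  have "summable (\<lambda>n. inverse (real (Suc n) ^ 2))"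
    using inverse_power_summable[of 2, where 'a=real] by (subst summable_Suc_iff) auto
  then show ?thesis by (simp add: inverse_eq_divide add.commute)
qed

text \<open>A positive limit would make the harmonic series converge.\<close>

lemma limit_zero_if_harmonically_summable:
  fixes h :: "nat \<Rightarrow> real"
  assumes nonneg: "\<And>k. 0 \<le> h k" and h: "convergent h" and sum: "summable (\<lambda>k. h k / (real k + 1))"
  shows "h \<longlonglongrightarrow> 0"
proof -
  obtain l where l: "h \<longlonglongrightarrow> l" using h by (auto simp: convergent_def)
  have "l \<ge> 0" using l nonneg by (intro LIMSEQ_le_const[OF l]) auto
  have "\<not> l > 0"
  proof
    assume "l > 0"
    then have "eventually (\<lambda>k. h k > l / 2) sequentially"
      using l by (intro order_tendstoD) auto
    then have "eventually (\<lambda>k. norm (inverse (real (Suc k))) \<le> (2 / l) * (h k / (real k + 1))) sequentially"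
    proof (rule eventually_mono)
      fix k assume "h k > l / 2"
      then have "1 \<le> 2 / l * h k" using \<open>l > 0\<close> by (simp add: field_simps)
      then have "1 / (real k + 1) \<le> (2 / l * h k) / (real k + 1)"
        by (intro divide_right_mono) auto
      then show "norm (inverse (real (Suc k))) \<le> (2 / l) * (h k / (real k + 1))"
        by (simp add: inverse_eq_divide add.commute)
    qed
    then have "summable (\<lambda>k. inverse (real (Suc k)))"
      by (rule summable_comparison_test_ev) (intro summable_mult sum)
    then show False
      using not_summable_harmonic[where 'a=real] by (subst (asm) summable_Suc_iff) auto
  qed
  then show ?thesis using l \<open>l \<ge> 0\<close> by simp
qed

text \<open>Opial's argument: boundedness yields a cluster point, which lies in \<open>Z\<close>, and the distances to
  it converge, hence converge to zero because they do so along a subsequence.\<close>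

lemma Opial_finite_dimensional:
  fixes u :: "nat \<Rightarrow> 'a::euclidean_space"
  assumes ne: "Z \<noteq> {}" and fejer: "\<And>z. z \<in> Z \<Longrightarrow> convergent (\<lambda>k. norm (u k - z))"
    and cluster: "\<And>r l. strict_mono r \<Longrightarrow> (u \<circ> r) \<longlonglongrightarrow> l \<Longrightarrow> l \<in> Z"
  shows "\<exists>l\<in>Z. u \<longlonglongrightarrow> l"
proof -
  obtain z where z: "z \<in> Z" using ne by blast
  have "Bseq (\<lambda>k. norm (u k - z))" using fejer[OF z] by (rule convergent_imp_Bseq)
  then have "Bseq (\<lambda>k. u k - z)" by (simp add: Bseq_def)
  then have "Bseq (\<lambda>k. (u k - z) + z)" by (rule Bseq_add)
  then have "bounded (range u)" by (simp add: Bseq_eq_bounded)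
  then obtain l r where r: "strict_mono r" "(u \<circ> r) \<longlonglongrightarrow> l"
    using bounded_imp_convergent_subsequence by blast
  have l: "l \<in> Z" using cluster[OF r] .
  obtain d where d: "(\<lambda>k. norm (u k - l)) \<longlonglongrightarrow> d" using fejer[OF l] by (auto simp: convergent_def)
  have "(\<lambda>k. norm ((u \<circ> r) k - l)) \<longlonglongrightarrow> norm (l - l)"
    by (intro tendsto_intros r)
  moreover have "(\<lambda>k. norm ((u \<circ> r) k - l)) \<longlonglongrightarrow> d"
    using LIMSEQ_subseq_LIMSEQ[OF d r(1)] by (simp add: o_def)
  ultimately have "d = 0" using LIMSEQ_unique by fastforce
  then have "(\<lambda>k. u k - l) \<longlonglongrightarrow> 0" using d tendsto_norm_zero_iff by blast
  then have "u \<longlonglongrightarrow> l" by (rule LIM_zero_cancel)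
  then show ?thesis using l by blast
qed

section \<open>One step of the iteration\<close>

lemma young_inner:
  fixes x y :: "'a::real_inner"
  assumes "g > 0"
  shows "- (g * (norm x)\<^sup>2 + h\<^sup>2 / g * (norm y)\<^sup>2) \<le> 2 * h * (x \<bullet> y)"
proof -
  have "0 \<le> (norm (g *\<^sub>R x + h *\<^sub>R y))\<^sup>2" by simp
  also have "\<dots> = g * (g * (norm x)\<^sup>2 + 2 * h * (x \<bullet> y) + h\<^sup>2 / g * (norm y)\<^sup>2)"
    using assms unfolding power2_norm_eq_inner
    by (simp add: inner_add_left inner_add_right inner_commute power2_eq_square algebra_simps)
  finally show ?thesis using assms by (simp add: zero_le_mult_iff)
qed

lemma norm_add_sq_le: "(norm (x + y))\<^sup>2 \<le> 2 * (norm x)\<^sup>2 + 2 * (norm y)\<^sup>2" for x y :: "'a::real_inner"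
  using zero_le_power2[of "norm (x - y)"] unfolding power2_norm_eq_inner
  by (simp add: inner_diff_left inner_diff_right inner_add_left inner_add_right inner_commute)

lemma weighted_young:
  fixes x y g :: real
  assumes "g > 0"
  shows "x * y \<le> g * x\<^sup>2 + 1 / (4 * g) * y\<^sup>2"
proof -
  have "0 \<le> (2 * g * x - y)\<^sup>2 / (4 * g)" using assms by simp
  also have "\<dots> = g * x\<^sup>2 - x * y + 1 / (4 * g) * y\<^sup>2"
    using assms by (simp add: power2_eq_square field_simps)
  finally show ?thesis by simp
qed

text \<open>One step for the part of the Lyapunov function that couples the residual \<open>S\<close> with the gap \<open>w\<close>
  between the anchor and the iterate; \<open>d\<close> is the increment of the iterate. The gain \<open>\<eta>\<close> is chosen such
  that \<open>d\<close> has a second representation \<open>w' / (t - 1) - 2 \<beta> (S + e)\<close> through the new gap. Multiplying the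
  cocoercivity inequality by \<open>t (t - 1)\<close>, using the new gap for \<open>S'\<close> and the old one for \<open>S\<close>, produces
  terms \<open>t \<langle>S', w'\<rangle>\<close> and \<open>(t - 1) \<langle>S, w\<rangle>\<close>, which telescope up to \<open>(1 - \<mu>) \<langle>S, w\<rangle>\<close>. The deficit
  \<open>2 \<beta> - \<eta>\<close> supplies a negative multiple of \<open>t \<parallel>S\<parallel>\<^sup>2\<close> that beats the growth \<open>2 \<beta> \<mu> t\<close> of the weights
  precisely when \<open>\<mu> < 2/3\<close>.\<close>

lemma coupled_step:
  fixes S S' w w' d e :: "'a::real_inner"
  assumes par: "0 < \<mu>" "\<mu> < 2 / 3" "0 < \<beta>" and t: "1 < t"
    and \<eta>: "\<eta> = 2 * \<beta> * (t - 1) / (t - \<mu> / 2)"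
    and d: "d = (1 / t) *\<^sub>R w - \<eta> *\<^sub>R (S + e)"
    and w': "w' = (1 - 1 / t) *\<^sub>R w + ((1 - \<mu> / 2) * \<eta>) *\<^sub>R (S + e)"
    and mono: "b * (norm (S' - S))\<^sup>2 + E \<le> (S' - S) \<bullet> d"
  shows "\<beta> * (t * (t - 1)) * (norm S')\<^sup>2 - t * (S' \<bullet> w') + (2 - 3 * \<mu>) * \<beta> * t * (norm S)\<^sup>2
      + (b - \<beta> - 2 * \<beta> * \<mu> / (2 - \<mu>)) * (t * (t - 1)) * (norm (S' - S))\<^sup>2 + t * (t - 1) * E
    \<le> \<beta> * ((t - \<mu>) * (t - \<mu> - 1)) * (norm S)\<^sup>2 - (t - \<mu>) * (S \<bullet> w) + (1 - \<mu>) * (S \<bullet> w)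
      + 2 * \<beta> * (norm S)\<^sup>2 + \<beta> / \<mu> * (t * (t - 1)) * (norm e)\<^sup>2 + 2 * \<beta> * t * (norm S * norm e)"
proof -
  have tpos: "t > 0" "t - 1 > 0" "t - \<mu> / 2 > 0" using t par by auto
  define a where "a = t * (t - 1)"
  have apos: "a > 0" using tpos by (simp add: a_def)
  define H where "H = a * (2 * \<beta> - \<eta>)"
  have \<eta>_eq: "(t - \<mu> / 2) * \<eta> = 2 * \<beta> * (t - 1)"
    using tpos by (simp add: \<eta>)
  \<comment> \<open>The two representations of the increment, through the old and through the new gap.\<close>
  have td: "t *\<^sub>R d = w - (t * \<eta>) *\<^sub>R (S + e)"
    using tpos by (simp add: d algebra_simps)
  have t1d: "(t - 1) *\<^sub>R d = w' - (2 * \<beta> * (t - 1)) *\<^sub>R (S + e)"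
  proof -
    have "(t - 1) * (1 / t) = 1 - 1 / t" using tpos by (simp add: field_simps)
    then have "(t - 1) *\<^sub>R d = (1 - 1 / t) *\<^sub>R w - ((t - 1) * \<eta>) *\<^sub>R (S + e)"
      unfolding d scaleR_diff_right scaleR_scaleR by simp
    also have "(t - 1) * \<eta> = 2 * \<beta> * (t - 1) - (1 - \<mu> / 2) * \<eta>"
      using \<eta>_eq by (simp add: algebra_simps)
    finally show ?thesis unfolding w' by (simp add: algebra_simps)
  qed
  have "a * (S' \<bullet> d) = t * (S' \<bullet> ((t - 1) *\<^sub>R d))" by (simp add: a_def)
  also have "\<dots> = t * (S' \<bullet> w') - 2 * \<beta> * a * (S' \<bullet> (S + e))"
    unfolding t1d by (simp add: inner_diff_right a_def algebra_simps)
  finally have S'd: "a * (S' \<bullet> d) = t * (S' \<bullet> w') - 2 * \<beta> * a * (S' \<bullet> (S + e))" .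
  have "a * (S \<bullet> d) = (t - 1) * (S \<bullet> (t *\<^sub>R d))" by (simp add: a_def)
  also have "\<dots> = (t - 1) * (S \<bullet> w) - \<eta> * a * (S \<bullet> (S + e))"
    unfolding td by (simp add: inner_diff_right a_def algebra_simps)
  finally have Sd: "a * (S \<bullet> d) = (t - 1) * (S \<bullet> w) - \<eta> * a * (S \<bullet> (S + e))" .
  have pol: "2 * (S' \<bullet> S) = (norm S')\<^sup>2 + (norm S)\<^sup>2 - (norm (S' - S))\<^sup>2"
    unfolding power2_norm_eq_inner by (simp add: inner_diff_left inner_diff_right inner_commute)
  define X where "X = (S' - S) \<bullet> e"
  have eX: "S' \<bullet> e = X + S \<bullet> e" by (simp add: X_def inner_diff_left)
  have "a * (b * (norm (S' - S))\<^sup>2 + E) \<le> a * ((S' - S) \<bullet> d)"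
    using mono apos by (intro mult_left_mono) auto
  also have "\<dots> = t * (S' \<bullet> w') - (t - 1) * (S \<bullet> w) - \<beta> * a * (2 * (S' \<bullet> S)) - 2 * \<beta> * a * (S' \<bullet> e)
      + \<eta> * a * (S \<bullet> S) + \<eta> * a * (S \<bullet> e)"
    using S'd Sd by (simp add: inner_diff_left inner_add_right algebra_simps)
  also have "\<dots> = t * (S' \<bullet> w') - (t - 1) * (S \<bullet> w)
      - \<beta> * a * (norm S')\<^sup>2 + \<beta> * a * (norm S)\<^sup>2 + \<beta> * a * (norm (S' - S))\<^sup>2
      - a * (2 * \<beta> * X) - H * (norm S)\<^sup>2 - H * (S \<bullet> e)"
    unfolding pol eX H_def power2_norm_eq_inner[symmetric] by (simp add: algebra_simps)
  finally have main: "a * (b * (norm (S' - S))\<^sup>2 + E) \<le> \<dots>" .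

  have H_eq: "H = 2 * \<beta> * (1 - \<mu> / 2) * (a / (t - \<mu> / 2))"
  proof -
    have "2 * \<beta> - \<eta> = 2 * \<beta> * (1 - \<mu> / 2) / (t - \<mu> / 2)"
    proof -
      have "(2 * \<beta> - \<eta>) * (t - \<mu> / 2) = 2 * \<beta> * (1 - \<mu> / 2)"
        using \<eta>_eq by (simp add: algebra_simps)
      then show ?thesis using tpos by (simp add: nonzero_eq_divide_eq)
    qed
    then show ?thesis by (simp add: H_def)
  qed
  have q: "t - 1 \<le> a / (t - \<mu> / 2)" "a / (t - \<mu> / 2) \<le> t"
  proof -
    have "(t - 1) * (t - \<mu> / 2) \<le> (t - 1) * t" using tpos par by (intro mult_left_mono) auto
    then show "t - 1 \<le> a / (t - \<mu> / 2)"
      using tpos by (simp only: pos_le_divide_eq a_def) (simp add: mult.commute)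
    have "t * (t - 1) \<le> t * (t - \<mu> / 2)" using tpos par by (intro mult_left_mono) auto
    then show "a / (t - \<mu> / 2) \<le> t"
      using tpos by (simp only: pos_divide_le_eq a_def)
  qed
  have H_ge: "2 * \<beta> * (1 - \<mu> / 2) * (t - 1) \<le> H"
    unfolding H_eq using q par by (intro mult_left_mono) auto
  have H_le: "H \<le> 2 * \<beta> * t"
  proof -
    have "2 * \<beta> * (1 - \<mu> / 2) * (a / (t - \<mu> / 2)) \<le> 2 * \<beta> * 1 * t"
      using q par tpos by (intro mult_mono) auto
    then show ?thesis by (simp add: H_eq)
  qed
  have H0: "0 \<le> H" 
    by (rule order_trans[OF _ H_ge]) (use par tpos in \<open>intro mult_nonneg_nonneg; simp\<close>)
  have Hp: "2 * \<beta> * (1 - \<mu> / 2) * (t - 1) * (norm S)\<^sup>2 \<le> H * (norm S)\<^sup>2"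
    using H_ge by (intro mult_right_mono) auto
  have He: "- (2 * \<beta> * t * (norm S * norm e)) \<le> H * (S \<bullet> e)"
  proof -
    have "\<bar>H * (S \<bullet> e)\<bar> \<le> (2 * \<beta> * t) * (norm S * norm e)"
      unfolding abs_mult using H_le H0 Cauchy_Schwarz_ineq2[of S e] par tpos by (intro mult_mono) auto
    then show ?thesis by linarith
  qed
  \<comment> \<open>The part of \<open>b - \<beta>\<close> spent on the correlation of \<open>S' - S\<close> with the error; the upper bound on \<open>\<beta>\<close> keeps
    \<open>b - \<beta> - g\<close> positive, and the price on the error is at most \<open>\<beta> / \<mu>\<close>.\<close>
  define g where "g = 2 * \<beta> * \<mu> / (2 - \<mu>)"
  define h where "h = \<beta> / \<mu>"
  have g: "g > 0" "\<beta>\<^sup>2 / g \<le> \<beta> / \<mu>"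
  proof -
    show "g > 0" using par by (simp add: g_def)
    have "\<beta>\<^sup>2 / g = \<beta> * (2 - \<mu>) / (2 * \<mu>)"
      using par by (simp add: g_def power2_eq_square)
    also have "\<dots> \<le> \<beta> * 2 / (2 * \<mu>)"
      using par by (intro divide_right_mono mult_left_mono) auto
    finally show "\<beta>\<^sup>2 / g \<le> \<beta> / \<mu>" using par by simp
  qed
  have "- (g * (norm (S' - S))\<^sup>2 + h * (norm e)\<^sup>2) \<le> 2 * \<beta> * X"
    using young_inner[OF g(1), of "S' - S" \<beta> e] mult_right_mono[OF g(2), of "(norm e)\<^sup>2"]
    unfolding X_def h_def by simp
  then have "a * - (g * (norm (S' - S))\<^sup>2 + h * (norm e)\<^sup>2) \<le> a * (2 * \<beta> * X)"
    using apos by (intro mult_left_mono) auto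
  then have Xe: "- (g * a * (norm (S' - S))\<^sup>2) - h * a * (norm e)\<^sup>2 \<le> a * (2 * \<beta> * X)"
    by (simp add: algebra_simps)
  have split: "\<beta> * a * (norm S)\<^sup>2 = \<beta> * ((t - \<mu>) * (t - \<mu> - 1)) * (norm S)\<^sup>2 + \<beta> * \<mu> * (2 * t) * (norm S)\<^sup>2
      - \<beta> * \<mu> * (\<mu> + 1) * (norm S)\<^sup>2"
    by (simp add: a_def algebra_simps)
  have coef: "\<beta> * \<mu> * (2 * t) * (norm S)\<^sup>2 - 2 * \<beta> * (1 - \<mu> / 2) * (t - 1) * (norm S)\<^sup>2
      = - ((2 - 3 * \<mu>) * \<beta> * t * (norm S)\<^sup>2) + 2 * \<beta> * (norm S)\<^sup>2 - \<beta> * \<mu> * (norm S)\<^sup>2"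
    by (simp add: algebra_simps)
  have drop: "0 \<le> \<beta> * \<mu> * (\<mu> + 1) * (norm S)\<^sup>2" "0 \<le> \<beta> * \<mu> * (norm S)\<^sup>2" using par by simp_all
  have Sw: "(t - 1) * (S \<bullet> w) = (t - \<mu>) * (S \<bullet> w) - (1 - \<mu>) * (S \<bullet> w)"
    by (simp add: algebra_simps)
  have D: "(b - \<beta> - g) * a * (norm (S' - S))\<^sup>2
      = a * (b * (norm (S' - S))\<^sup>2) - \<beta> * a * (norm (S' - S))\<^sup>2 - g * a * (norm (S' - S))\<^sup>2"
    by (simp add: algebra_simps)
  have aE: "a * (b * (norm (S' - S))\<^sup>2 + E) = a * (b * (norm (S' - S))\<^sup>2) + a * E"
    by (simp add: algebra_simps)
  \<comment> \<open>The remaining step is linear in the monomials; abstracting them makes it pure linear arithmetic.\<close>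
  have combine: "p1 - tw + q + dD + aEE \<le> p0 - sw' + sw + tp + hh + l"
    if "ab \<le> tw - sw1 - p1 + ap + ad - x - hp - hse" "lp \<le> hp" "- l \<le> hse" "- gd - hh \<le> x"
      "ap = p0 + m2 - m1" "m2 - lp = - q + tp - m0" "0 \<le> m1" "0 \<le> m0" "sw1 = sw' - sw" "dD = abd - ad - gd" "ab = abd + aEE"
    for p1 tw q dD aEE p0 sw sw' tp hh l ab sw1 ap ad x hp hse lp gd m1 m2 m0 abd :: real
    using that by linarith
  show ?thesis
    unfolding g_def[symmetric] a_def[symmetric] h_def[symmetric]
    by (rule combine[OF main Hp He Xe split coef drop Sw D aE])
qed

text \<open>One step for the squared distance of the anchor \<open>s\<close> to a zero \<open>z\<close>. Its coefficient is chosen such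
  that the inner product \<open>\<langle>S, s - z\<rangle>\<close> appears with factor \<open>1 - \<mu>\<close>, which cancels the term left over in
  the coupling part.\<close>

lemma anchor_step:
  fixes s z S e w u :: "'a::real_inner"
  assumes "0 < \<mu>" "\<mu> < 2 / 3" "\<eta> > 0" "\<eta> \<le> 2 * \<beta>"
    and s': "s' = s - (\<mu> / 2 * \<eta>) *\<^sub>R (S + e)" and w: "w = s - u"
    and zero: "0 \<le> S \<bullet> (u - z)"
  shows "(1 - \<mu>) / (\<mu> * \<eta>) * (norm (s' - z))\<^sup>2 + (1 - \<mu>) * (S \<bullet> w)
    \<le> (1 - \<mu>) / (\<mu> * \<eta>) * (norm (s - z))\<^sup>2 + norm e * norm (s - z)
      + \<mu> * \<beta> * (norm S)\<^sup>2 + \<mu> * \<beta> * (norm e)\<^sup>2"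
proof -
  define c where "c = (1 - \<mu>) / (\<mu> * \<eta>)"
  have c: "c * (\<mu> * \<eta>) = 1 - \<mu>" using assms by (simp add: c_def)
  have "s' - z = (s - z) - (\<mu> / 2 * \<eta>) *\<^sub>R (S + e)" by (simp add: s')
  then have "(norm (s' - z))\<^sup>2 = (norm (s - z))\<^sup>2 - \<mu> * \<eta> * ((S + e) \<bullet> (s - z)) + (\<mu> * \<eta>) * (\<mu> * \<eta> / 4) * (norm (S + e))\<^sup>2"
    unfolding power2_norm_eq_inner \<open>s' - z = _\<close>
    by (simp add: inner_diff_left inner_diff_right inner_add_left inner_add_right inner_commute algebra_simps)
  then have "c * (norm (s' - z))\<^sup>2 = c * ((norm (s - z))\<^sup>2 - \<mu> * \<eta> * ((S + e) \<bullet> (s - z)) + (\<mu> * \<eta>) * (\<mu> * \<eta> / 4) * (norm (S + e))\<^sup>2)"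
    by (rule arg_cong)
  also have "\<dots> = c * (norm (s - z))\<^sup>2 - c * (\<mu> * \<eta>) * ((S + e) \<bullet> (s - z))
      + c * (\<mu> * \<eta>) * (\<mu> * \<eta> / 4) * (norm (S + e))\<^sup>2"
    by (simp add: algebra_simps)
  finally have "c * (norm (s' - z))\<^sup>2 = c * (norm (s - z))\<^sup>2 - c * (\<mu> * \<eta>) * ((S + e) \<bullet> (s - z))
      + c * (\<mu> * \<eta>) * (\<mu> * \<eta> / 4) * (norm (S + e))\<^sup>2" .
  then have "c * (norm (s' - z))\<^sup>2 = c * (norm (s - z))\<^sup>2 - (1 - \<mu>) * ((S + e) \<bullet> (s - z))
      + (1 - \<mu>) * (\<mu> * \<eta> / 4) * (norm (S + e))\<^sup>2"
    unfolding c .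
  moreover have "(1 - \<mu>) * ((S + e) \<bullet> (s - z)) \<ge> (1 - \<mu>) * (S \<bullet> w) - norm e * norm (s - z)"
  proof -
    have "(S + e) \<bullet> (s - z) = S \<bullet> w + S \<bullet> (u - z) + e \<bullet> (s - z)"
      by (simp add: w inner_add_left inner_diff_right)
    then have "(1 - \<mu>) * ((S + e) \<bullet> (s - z)) = (1 - \<mu>) * (S \<bullet> w) + (1 - \<mu>) * (S \<bullet> (u - z)) + (1 - \<mu>) * (e \<bullet> (s - z))"
      by (simp add: distrib_left)
    moreover
    have "0 \<le> (1 - \<mu>) * (S \<bullet> (u - z))" using assms by simp
    moreover have "\<bar>(1 - \<mu>) * (e \<bullet> (s - z))\<bar> \<le> 1 * (norm e * norm (s - z))"
      unfolding abs_mult using assms Cauchy_Schwarz_ineq2 by (intro mult_mono) auto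
    ultimately show ?thesis by linarith
  qed
  moreover have "(1 - \<mu>) * (\<mu> * \<eta> / 4) * (norm (S + e))\<^sup>2 \<le> \<mu> * \<beta> * (norm S)\<^sup>2 + \<mu> * \<beta> * (norm e)\<^sup>2"
  proof -
    have "(norm (S + e))\<^sup>2 \<le> 2 * ((norm S)\<^sup>2 + (norm e)\<^sup>2)"
      using zero_le_power2[of "norm (S - e)"] unfolding power2_norm_eq_inner
      by (simp add: inner_diff_left inner_diff_right inner_add_left inner_add_right inner_commute)
    moreover have "(1 - \<mu>) * (\<mu> * \<eta> / 4) \<le> 1 * (\<mu> * (2 * \<beta>) / 4)"
      using assms by (intro mult_mono divide_right_mono) auto
    ultimately have "(1 - \<mu>) * (\<mu> * \<eta> / 4) * (norm (S + e))\<^sup>2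
       \<le> 1 * (\<mu> * (2 * \<beta>) / 4) * (2 * ((norm S)\<^sup>2 + (norm e)\<^sup>2))"
      using assms by (intro mult_mono) auto
    then show ?thesis by (simp add: algebra_simps)
  qed
  ultimately show ?thesis unfolding c_def[symmetric] by linarith
qed

section \<open>Weights and the potential\<close>

text \<open>Here \<open>b\<close> is the cocoercivity constant of the residual, and \<open>\<Lambda>\<close> is the multiple of the mean square
  difference that is left over in the cocoercivity inequality.\<close>

locale vfosa_parameters =
  fixes \<mu> \<beta> b \<Lambda> r :: real
  assumes \<mu>: "0 < \<mu>" "\<mu> < 2 / 3" and \<beta>: "0 < \<beta>" "\<beta> < (2 - \<mu>) * b / (2 + \<mu>)"
    and \<Lambda>: "0 \<le> \<Lambda>" and r: "2 + 1 / \<mu> \<le> r"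
begin

text \<open>The sequence \<open>\<tau> k\<close> is \<open>t\<^sub>k\<close>, and \<open>weight k\<close> is \<open>t\<^sub>k\<^sub>-\<^sub>1 (t\<^sub>k\<^sub>-\<^sub>1 - 1)\<close>, so that the step from \<open>k\<close> to \<open>k + 1\<close>
  is weighted by \<open>weight (Suc k)\<close>.\<close>

definition \<tau> :: "nat \<Rightarrow> real" where "\<tau> k = \<mu> * (real k + r)"

definition gain :: "nat \<Rightarrow> real" where "gain k = 2 * \<beta> * (\<tau> k - 1) / (\<tau> k - \<mu> / 2)"

definition weight :: "nat \<Rightarrow> real" where "weight k = (\<tau> k - \<mu>) * (\<tau> k - \<mu> - 1)"

text \<open>The Lyapunov function of the iteration, for residual \<open>S\<close>, iterate \<open>u\<close>, anchor \<open>s\<close> and a zero \<open>z\<close>.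
  It is stated for vectors rather than for trajectories so that the same constants serve all
  realisations at once.\<close>

definition potential :: "nat \<Rightarrow> 'a::real_inner \<Rightarrow> 'a \<Rightarrow> 'a \<Rightarrow> 'a \<Rightarrow> real" where
  "potential k z S u s = \<beta> * weight k * (norm S)\<^sup>2 - (\<tau> k - \<mu>) * (S \<bullet> (s - u))
     + (1 - \<mu>) / (\<mu> * gain k) * (norm (s - z))\<^sup>2"

text \<open>The coefficient of \<open>\<parallel>S' - S\<parallel>\<^sup>2\<close> that survives in a step of the coupling part; it is positive exactly
  under the assumed upper bound on \<open>\<beta>\<close>.\<close>

definition margin :: real where "margin = b - \<beta> - 2 * \<beta> * \<mu> / (2 - \<mu>)"

text \<open>If the anchor coefficient is replaced by its limit \<open>c = (1 - \<mu>) / (2 \<beta> \<mu>)\<close>, then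
  \<open>\<theta> = 1 / (4 \<beta> c)\<close>, so that \<open>\<theta> < 1\<close> says that the form \<open>\<beta> X\<^sup>2 - X Y + c Y\<^sup>2\<close> is positive definite; this is
  again the condition \<open>\<mu> < 2/3\<close>. The midpoint of \<open>\<theta>\<close> and \<open>1\<close> is used to extract the lower bound \<open>\<delta>\<close>.\<close>

definition \<theta> :: real where "\<theta> = \<mu> / (2 * (1 - \<mu>))"

definition \<delta> :: real where
  "\<delta> = min (\<beta> * (1 - (1 + \<theta>) / 2)) ((1 - \<mu>) / (2 * \<beta> * \<mu>) * (1 - \<theta> / ((1 + \<theta>) / 2)))"

text \<open>All error terms that are not charged to the estimator are at most \<open>growth / weight (Suc k)\<close> times the
  potential, a summable relative growth.\<close>

definition growth :: real where "growth = (8 * \<beta> * \<mu> + \<mu> / (4 * \<beta>) + 8 * \<beta>) / \<delta>"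

lemma \<tau>_ge: "\<mu> * (real k + 2) + 1 \<le> \<tau> k"
proof -
  have "\<mu> * (2 + 1 / \<mu>) \<le> \<mu> * r" using r \<mu> by (intro mult_left_mono) auto
  then show ?thesis using \<mu> by (simp add: \<tau>_def algebra_simps)
qed

lemma \<tau>_bounds: "1 + 2 * \<mu> \<le> \<tau> k" "\<mu> * (real k + 1) \<le> \<tau> k"
proof -
  define w where "w = \<mu> * real k"
  have w: "0 \<le> w" "w + 2 * \<mu> + 1 \<le> \<tau> k"
    using \<tau>_ge[of k] \<mu> by (simp_all add: w_def algebra_simps)
  then show "1 + 2 * \<mu> \<le> \<tau> k" by simp
  show "\<mu> * (real k + 1) \<le> \<tau> k" using w \<mu> by (simp add: w_def distrib_left)
qed

lemma \<tau>_Suc: "\<tau> (Suc k) = \<tau> k + \<mu>"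
  by (simp add: \<tau>_def algebra_simps)

lemma weight_Suc: "weight (Suc k) = \<tau> k * (\<tau> k - 1)"
  by (simp add: weight_def \<tau>_Suc)

lemma r_ge_1: "1 \<le> r"
proof -
  have "0 \<le> 1 / \<mu>" using \<mu> by simp
  then show ?thesis using r by linarith
qed

lemma \<tau>_le: "\<tau> k \<le> \<mu> * r * (real k + 1)"
proof -
  have "real k * 1 \<le> real k * r" using r_ge_1 by (intro mult_left_mono) auto
  then have "\<mu> * (real k + r) \<le> \<mu> * (r * (real k + 1))"
    using \<mu> by (intro mult_left_mono) (auto simp: algebra_simps)
  then show ?thesis by (simp add: \<tau>_def mult.assoc)
qed

lemma weight_ge: "\<mu>\<^sup>2 * (real k + 1)\<^sup>2 \<le> weight k"
proof -
  have "(\<mu> * (real k + 1)) * (\<mu> * (real k + 1)) \<le> (\<tau> k - \<mu>) * (\<tau> k - \<mu> - 1)"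
    using \<tau>_ge[of k] \<tau>_bounds(1)[of k] \<mu> by (intro mult_mono) (auto simp: algebra_simps)
  then show ?thesis by (simp add: weight_def power2_eq_square mult.assoc mult.left_commute)
qed

lemma weight_pos: "0 < weight k"
  using weight_ge[of k] \<mu> by (smt (verit) mult_pos_pos of_nat_0_le_iff zero_less_power)

lemma weight_le: "weight k \<le> (\<mu> * r * (real k + 1))\<^sup>2"
proof -
  have "(\<tau> k - \<mu>) * (\<tau> k - \<mu> - 1) \<le> (\<mu> * r * (real k + 1)) * (\<mu> * r * (real k + 1))"
    using \<tau>_le[of k] \<tau>_bounds[of k] \<mu> by (intro mult_mono) auto
  then show ?thesis by (simp add: weight_def power2_eq_square)
qed

lemma summable_inverse_weight: "summable (\<lambda>k. K / weight (Suc k))"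
proof -
  have "summable (\<lambda>k. \<bar>K\<bar> / \<mu>\<^sup>2 * (1 / (real k + 1)\<^sup>2))"
    by (intro summable_mult summable_inverse_squares)
  moreover have "norm (K / weight (Suc k)) \<le> \<bar>K\<bar> / \<mu>\<^sup>2 * (1 / (real k + 1)\<^sup>2)" for k
  proof -
    have "\<mu>\<^sup>2 * (real k + 1)\<^sup>2 \<le> \<mu>\<^sup>2 * (real (Suc k) + 1)\<^sup>2"
      by (intro mult_left_mono power_mono) auto
    also have "\<dots> \<le> weight (Suc k)" by (rule weight_ge)
    finally have "\<bar>K\<bar> / weight (Suc k) \<le> \<bar>K\<bar> / (\<mu>\<^sup>2 * (real k + 1)\<^sup>2)"
      using \<mu> by (intro divide_left_mono) (auto intro!: mult_pos_pos weight_pos)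
    then show ?thesis using weight_pos[of "Suc k"] by (simp add: abs_mult)
  qed
  ultimately show ?thesis by (rule summable_comparison_test'[where N = 0])
qed

lemma gain_pos: "0 < gain k"
  using \<tau>_bounds[of k] \<mu> \<beta> unfolding gain_def by (intro divide_pos_pos mult_pos_pos) auto

lemma gain_le: "gain k \<le> 2 * \<beta>"
proof -
  have "2 * \<beta> * (\<tau> k - 1) \<le> 2 * \<beta> * (\<tau> k - \<mu> / 2)" using \<mu> \<beta> by (intro mult_left_mono) auto
  then show ?thesis using \<tau>_bounds(1)[of k] \<mu> unfolding gain_def by (subst pos_divide_le_eq) auto
qed

text \<open>The gains increase to \<open>2 \<beta>\<close>, hence the anchor coefficients decrease to a positive limit.\<close>

lemma gain_mono: "gain k \<le> gain (Suc k)"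
proof -
  let ?D = "\<lambda>k. \<tau> k - \<mu> / 2"
  have D: "?D k > 0" "?D (Suc k) > 0" using \<tau>_bounds[of k] \<mu> \<tau>_Suc[of k] by auto
  have eq: "gain j = 2 * \<beta> - 2 * \<beta> * (1 - \<mu> / 2) / ?D j" if "?D j > 0" for j
    using that by (simp add: gain_def field_simps)
  have "2 * \<beta> * (1 - \<mu> / 2) / ?D (Suc k) \<le> 2 * \<beta> * (1 - \<mu> / 2) / ?D k"
    using D \<mu> \<beta> by (intro divide_left_mono) (auto simp: \<tau>_Suc)
  then show ?thesis using eq D by simp
qed

lemma anchor_coefficient:
  "(1 - \<mu>) / (\<mu> * gain (Suc k)) \<le> (1 - \<mu>) / (\<mu> * gain k)"
  "(1 - \<mu>) / (2 * \<beta> * \<mu>) \<le> (1 - \<mu>) / (\<mu> * gain k)"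
proof -
  show "(1 - \<mu>) / (\<mu> * gain (Suc k)) \<le> (1 - \<mu>) / (\<mu> * gain k)"
    using gain_mono[of k] gain_pos[of k] gain_pos[of "Suc k"] \<mu> by (intro divide_left_mono mult_left_mono) auto
  have "\<mu> * gain k \<le> 2 * \<beta> * \<mu>" using gain_le[of k] \<mu> by simp
  then show "(1 - \<mu>) / (2 * \<beta> * \<mu>) \<le> (1 - \<mu>) / (\<mu> * gain k)"
    using gain_pos[of k] \<mu> \<beta> by (intro divide_left_mono) auto
qed

lemma b_gt: "\<beta> * (2 + \<mu>) < (2 - \<mu>) * b" "\<beta> \<le> b"
proof -
  show *: "\<beta> * (2 + \<mu>) < (2 - \<mu>) * b" using \<beta> \<mu> by (simp add: pos_less_divide_eq)
  have "(2 - \<mu>) * \<beta> \<le> \<beta> * (2 + \<mu>)" using \<mu> \<beta> by (simp add: algebra_simps)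
  then have "(2 - \<mu>) * \<beta> < (2 - \<mu>) * b" using * by linarith
  then show "\<beta> \<le> b" using \<mu> by simp
qed

lemma margin_pos: "0 < margin"
proof -
  have "(2 - \<mu>) * margin = (2 - \<mu>) * b - \<beta> * (2 + \<mu>)"
  proof -
    have "(2 - \<mu>) * (2 * \<beta> * \<mu> / (2 - \<mu>)) = 2 * \<beta> * \<mu>" using \<mu> by simp
    then show ?thesis unfolding margin_def right_diff_distrib by (simp add: algebra_simps)
  qed
  then have "0 < (2 - \<mu>) * margin" using b_gt by simp
  then show ?thesis using \<mu> by (simp add: zero_less_mult_iff)
qed

lemma \<theta>: "0 < \<theta>" "\<theta> < 1"
  using \<mu> by (auto simp: \<theta>_def)

lemma \<delta>_pos: "0 < \<delta>"
  using \<theta> \<mu> \<beta> by (simp add: \<delta>_def)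

lemma growth_nonneg: "0 \<le> growth"
  using \<delta>_pos \<mu> \<beta> by (simp add: growth_def)

lemma quadratic_lower_bound:
  fixes X Y c :: real
  assumes c: "(1 - \<mu>) / (2 * \<beta> * \<mu>) \<le> c"
  shows "\<delta> * (X\<^sup>2 + Y\<^sup>2) \<le> \<beta> * X\<^sup>2 - X * Y + c * Y\<^sup>2"
proof -
  define m where "m = (1 + \<theta>) / 2"
  define c0 where "c0 = (1 - \<mu>) / (2 * \<beta> * \<mu>)"
  have m: "m > 0" using \<theta> by (simp add: m_def)
  have c0: "4 * \<beta> * c0 * \<theta> = 1" using \<mu> \<beta> by (simp add: c0_def \<theta>_def field_simps)
  have "1 / (4 * (\<beta> * m)) = c0 * \<theta> / m"
    using c0 m \<beta> by (simp add: field_simps)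
  then have "X * Y \<le> \<beta> * m * X\<^sup>2 + c0 * \<theta> / m * Y\<^sup>2"
    using weighted_young[of "\<beta> * m" X Y] m \<beta> by simp
  moreover have "\<delta> * X\<^sup>2 \<le> \<beta> * (1 - m) * X\<^sup>2"
    by (intro mult_right_mono) (auto simp: \<delta>_def m_def)
  moreover have "\<delta> * Y\<^sup>2 \<le> c0 * (1 - \<theta> / m) * Y\<^sup>2"
    by (intro mult_right_mono) (auto simp: \<delta>_def m_def c0_def)
  moreover have "c0 * Y\<^sup>2 \<le> c * Y\<^sup>2" using c by (intro mult_right_mono) (auto simp: c0_def)
  ultimately show ?thesis by (simp add: algebra_simps)
qed

text \<open>Splitting \<open>s - u = (s - z) - (u - z)\<close>, cocoercivity at the zero \<open>z\<close> contributes \<open>\<beta> T \<parallel>S\<parallel>\<^sup>2\<close> with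
  \<open>T = \<tau> k - \<mu>\<close>, which completes \<open>weight k = T (T - 1)\<close> to \<open>T\<^sup>2\<close>; what remains is a positive definite
  form in \<open>T \<parallel>S\<parallel>\<close> and \<open>\<parallel>s - z\<parallel>\<close>.\<close>

lemma potential_coercive:
  fixes S u s z :: "'a::real_inner"
  assumes zero: "b * (norm S)\<^sup>2 \<le> S \<bullet> (u - z)"
  shows "\<delta> * (((\<tau> k - \<mu>) * norm S)\<^sup>2 + (norm (s - z))\<^sup>2) \<le> potential k z S u s"
proof -
  define T where "T = \<tau> k - \<mu>"
  have T: "T \<ge> 0" using \<tau>_bounds[of k] \<mu> by (simp add: T_def)
  have "S \<bullet> (s - u) = S \<bullet> (s - z) - S \<bullet> (u - z)" by (simp add: inner_diff_right)
  also have "\<dots> \<le> norm S * norm (s - z) - \<beta> * (norm S)\<^sup>2"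
    using norm_cauchy_schwarz[of S "s - z"] zero mult_right_mono[OF b_gt(2), of "(norm S)\<^sup>2"] by simp
  finally have "T * (S \<bullet> (s - u)) \<le> T * (norm S * norm (s - z) - \<beta> * (norm S)\<^sup>2)"
    using T by (rule mult_left_mono)
  moreover have "weight k = T * T - T" by (simp add: weight_def T_def algebra_simps)
  moreover have "\<beta> * (T * T - T) * (norm S)\<^sup>2 + T * (\<beta> * (norm S)\<^sup>2) = \<beta> * (T * norm S)\<^sup>2"
    by (simp add: power2_eq_square algebra_simps)
  moreover have "T * (norm S * norm (s - z) - \<beta> * (norm S)\<^sup>2) = (T * norm S) * norm (s - z) - T * (\<beta> * (norm S)\<^sup>2)"
    by (simp add: algebra_simps)
  ultimately have "\<beta> * (T * norm S)\<^sup>2 - (T * norm S) * norm (s - z) + (1 - \<mu>) / (\<mu> * gain k) * (norm (s - z))\<^sup>2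
      \<le> potential k z S u s"
    unfolding potential_def T_def[symmetric] by simp
  then show ?thesis
    using quadratic_lower_bound[OF anchor_coefficient(2)[of k], of "T * norm S" "norm (s - z)"]
    unfolding T_def by linarith
qed

lemma potential_nonneg:
  fixes S u s z :: "'a::real_inner"
  assumes "b * (norm S)\<^sup>2 \<le> S \<bullet> (u - z)"
  shows "0 \<le> potential k z S u s"
  by (rule order_trans[OF _ potential_coercive[OF assms]]) (use \<delta>_pos in simp)

text \<open>Young's inequality (for the last term, \<open>\<mu>\<^sup>2 \<le> weight (Suc k)\<close>) charges \<open>weight (Suc k) * \<parallel>e\<parallel>\<^sup>2\<close> with \<open>\<beta> / \<mu>\<close> for each of the three error terms. The
  complementary squares are of order \<open>\<parallel>S\<parallel>\<^sup>2\<close> and \<open>\<parallel>s - z\<parallel>\<^sup>2 / weight (Suc k)\<close>, both of which coercivity bounds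
  by the potential divided by the weight.\<close>

lemma error_absorption:
  fixes S u s z e :: "'a::real_inner"
  assumes zero: "b * (norm S)\<^sup>2 \<le> S \<bullet> (u - z)"
  shows "(2 * \<beta> + \<mu> * \<beta>) * (norm S)\<^sup>2 + 2 * \<beta> * \<tau> k * (norm S * norm e) + norm e * norm (s - z) + \<mu> * \<beta> * (norm e)\<^sup>2
    \<le> growth / weight (Suc k) * potential k z S u s + 3 * \<beta> / \<mu> * weight (Suc k) * (norm e)\<^sup>2"
proof -
  define a where "a = weight (Suc k)"
  define t where "t = \<tau> k"
  define n where "n = norm S"
  define p where "p = norm (s - z)"
  define q where "q = norm e"
  define V where "V = potential k z S u s"
  have t: "t \<ge> 1 + 2 * \<mu>" "t > 0" using \<tau>_bounds(1)[of k] \<mu> by (auto simp: t_def)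
  have a: "a = t * (t - 1)" "a > 0" using weight_pos[of "Suc k"] by (auto simp: a_def weight_Suc t_def)
  have V: "\<delta> * ((t - \<mu>) * n)\<^sup>2 + \<delta> * p\<^sup>2 \<le> V"
    using potential_coercive[OF zero, of k s] by (simp add: V_def t_def n_def p_def distrib_left)
  have tn: "t\<^sup>2 * n\<^sup>2 \<le> 4 * ((t - \<mu>) * n)\<^sup>2"
  proof -
    have "t\<^sup>2 * n\<^sup>2 \<le> (2 * (t - \<mu>))\<^sup>2 * n\<^sup>2"
      using t \<mu> by (intro mult_right_mono power_mono) auto
    then show ?thesis unfolding power_mult_distrib by simp
  qed
  have a_le: "a \<le> t\<^sup>2" using a t by (simp add: power2_eq_square)
  have n_le: "n\<^sup>2 \<le> t\<^sup>2 * n\<^sup>2 / a"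
  proof -
    have "n\<^sup>2 * a \<le> n\<^sup>2 * t\<^sup>2" using a_le by (intro mult_left_mono) auto
    then show ?thesis using a(2) by (simp add: pos_le_divide_eq mult.commute)
  qed
  have c1: "(2 * \<beta> + \<mu> * \<beta>) * n\<^sup>2 \<le> (2 * \<beta> + \<mu> * \<beta>) * (t\<^sup>2 * n\<^sup>2 / a)"
    using n_le \<mu> \<beta> by (intro mult_left_mono) auto
  have c2: "2 * \<beta> * t * (n * q) \<le> \<beta> / \<mu> * a * q\<^sup>2 + \<beta> * \<mu> * (t\<^sup>2 * n\<^sup>2 / a)"
  proof -
    have g: "\<beta> / \<mu> * a > 0" using a \<mu> \<beta> by simp
    have "q * (2 * \<beta> * t * n) \<le> (\<beta> / \<mu> * a) * q\<^sup>2 + 1 / (4 * (\<beta> / \<mu> * a)) * (2 * \<beta> * t * n)\<^sup>2"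
      by (rule weighted_young[OF g])
    also have "1 / (4 * (\<beta> / \<mu> * a)) * (2 * \<beta> * t * n)\<^sup>2 = \<beta> * \<mu> * (t\<^sup>2 * n\<^sup>2 / a)"
      using a(2) \<mu> \<beta> by (simp add: power2_eq_square)
    finally show ?thesis by (simp add: mult.commute mult.left_commute mult.assoc)
  qed
  have c3: "q * p \<le> \<beta> / \<mu> * a * q\<^sup>2 + \<mu> / (4 * \<beta>) * (p\<^sup>2 / a)"
  proof -
    have g: "\<beta> / \<mu> * a > 0" using a \<mu> \<beta> by simp
    have "q * p \<le> (\<beta> / \<mu> * a) * q\<^sup>2 + 1 / (4 * (\<beta> / \<mu> * a)) * p\<^sup>2"
      by (rule weighted_young[OF g])
    also have "1 / (4 * (\<beta> / \<mu> * a)) * p\<^sup>2 = \<mu> / (4 * \<beta>) * (p\<^sup>2 / a)"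
      using a(2) \<mu> \<beta> by (simp add: power2_eq_square)
    finally show ?thesis .
  qed
  have c4: "\<mu> * \<beta> * q\<^sup>2 \<le> \<beta> / \<mu> * a * q\<^sup>2"
  proof (rule mult_right_mono)
    have "\<mu> * \<mu> \<le> (1 + 2 * \<mu>) * (2 * \<mu>)" using \<mu> by (simp add: algebra_simps)
    also have "\<dots> \<le> t * (t - 1)" using t \<mu> by (intro mult_mono) auto
    finally have "\<mu> * \<mu> \<le> a" by (simp add: a(1))
    then have "\<beta> / \<mu> * (\<mu> * \<mu>) \<le> \<beta> / \<mu> * a" using \<mu> \<beta> by (intro mult_left_mono) auto
    then show "\<mu> * \<beta> \<le> \<beta> / \<mu> * a" using \<mu> by (simp add: mult.commute)
  qed simp
  have "(2 * \<beta> + 2 * \<mu> * \<beta>) * (t\<^sup>2 * n\<^sup>2 / a) + \<mu> / (4 * \<beta>) * (p\<^sup>2 / a) \<le> growth / a * V"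
  proof -
    have "0 \<le> \<delta> * p\<^sup>2" "0 \<le> \<delta> * ((t - \<mu>) * n)\<^sup>2" using \<delta>_pos by auto
    then have "\<delta> * ((t - \<mu>) * n)\<^sup>2 \<le> V" "\<delta> * p\<^sup>2 \<le> V"
      using V by linarith+
    then have Vn: "((t - \<mu>) * n)\<^sup>2 \<le> V / \<delta>" and Vp: "p\<^sup>2 \<le> V / \<delta>"
      using \<delta>_pos by (simp_all add: pos_le_divide_eq mult.commute)
    have "(2 * \<beta> + 2 * \<mu> * \<beta>) * (t\<^sup>2 * n\<^sup>2) + \<mu> / (4 * \<beta>) * p\<^sup>2
      \<le> (2 * \<beta> + 2 * \<mu> * \<beta>) * (4 * (V / \<delta>)) + \<mu> / (4 * \<beta>) * (V / \<delta>)"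
      using tn Vn Vp \<mu> \<beta> by (intro add_mono mult_left_mono) auto
    also have "\<dots> = growth * V" 
      unfolding growth_def by (simp add: algebra_simps add_divide_distrib)
    finally have "((2 * \<beta> + 2 * \<mu> * \<beta>) * (t\<^sup>2 * n\<^sup>2) + \<mu> / (4 * \<beta>) * p\<^sup>2) / a \<le> growth * V / a"
      using a(2) by (intro divide_right_mono) auto
    then show ?thesis by (simp add: add_divide_distrib)
  qed
  moreover have "(2 * \<beta> + 2 * \<mu> * \<beta>) * (t\<^sup>2 * n\<^sup>2 / a)
      = (2 * \<beta> + \<mu> * \<beta>) * (t\<^sup>2 * n\<^sup>2 / a) + \<beta> * \<mu> * (t\<^sup>2 * n\<^sup>2 / a)"
    by (simp only: distrib_right[symmetric]) (simp add: algebra_simps)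
  ultimately have "(2 * \<beta> + \<mu> * \<beta>) * n\<^sup>2 + 2 * \<beta> * t * (n * q) + q * p + \<mu> * \<beta> * q\<^sup>2
    \<le> growth / a * V + 3 * (\<beta> / \<mu> * a * q\<^sup>2)"
    using c1 c2 c3 c4 by linarith
  then show ?thesis
    unfolding a_def t_def n_def p_def q_def V_def by (simp add: mult.assoc)
qed

end

section \<open>Pathwise convergence\<close>

text \<open>One realisation of the method, with residuals \<open>S\<close>, estimation errors \<open>e\<close> and mean square
  differences \<open>E\<close>; how the residuals depend on the iterates enters through cocoercivity only.\<close>

locale vfosa_trajectory = vfosa_parameters \<mu> \<beta> b \<Lambda> r
  for \<mu> \<beta> b \<Lambda> r :: real +
  fixes S u s e :: "nat \<Rightarrow> 'a::euclidean_space" and E :: "nat \<Rightarrow> real"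
  assumes u_Suc: "u (Suc k) = u k + (1 / \<tau> k) *\<^sub>R (s k - u k) - gain k *\<^sub>R (S k + e k)"
    and s_Suc: "s (Suc k) = s k - (\<mu> / 2 * gain k) *\<^sub>R (S k + e k)"
    and cocoercive: "b * (norm (S (Suc k) - S k))\<^sup>2 + \<Lambda> * E (Suc k) \<le> (S (Suc k) - S k) \<bullet> (u (Suc k) - u k)"
    and E_nonneg: "0 \<le> E k"
begin

definition coupling :: "nat \<Rightarrow> real" where
  "coupling k = \<beta> * weight k * (norm (S k))\<^sup>2 - (\<tau> k - \<mu>) * (S k \<bullet> (s k - u k))"

lemma \<tau>_pos: "0 < \<tau> k"
  using \<tau>_bounds(1)[of k] \<mu> by simp

lemma gap_Suc:
  "s (Suc k) - u (Suc k) = (1 - 1 / \<tau> k) *\<^sub>R (s k - u k) + ((1 - \<mu> / 2) * gain k) *\<^sub>R (S k + e k)"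
  unfolding u_Suc s_Suc by (simp add: algebra_simps)

text \<open>The first two terms of the potential do not involve a zero. Their own telescoping inequality is
  what yields the little-o rate.\<close>

lemma coupling_step:
  "coupling (Suc k) + (2 - 3 * \<mu>) * \<beta> * \<tau> k * (norm (S k))\<^sup>2
      + margin * weight (Suc k) * (norm (S (Suc k) - S k))\<^sup>2 + weight (Suc k) * (\<Lambda> * E (Suc k))
    \<le> coupling k + (1 - \<mu>) * (S k \<bullet> (s k - u k)) + 2 * \<beta> * (norm (S k))\<^sup>2
      + \<beta> / \<mu> * weight (Suc k) * (norm (e k))\<^sup>2 + 2 * \<beta> * \<tau> k * (norm (S k) * norm (e k))"
proof -
  have "1 < \<tau> k" using \<tau>_bounds(1)[of k] \<mu> by simp
  from coupled_step[OF \<mu> \<beta>(1) this gain_def, of "u (Suc k) - u k" "s k - u k" "S k" "e k" "s (Suc k) - u (Suc k)" b "S (Suc k)" "\<Lambda> * E (Suc k)", OF _ gap_Suc cocoercive]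
  show ?thesis
    unfolding coupling_def weight_Suc margin_def weight_def[of k] \<tau>_Suc by (simp add: u_Suc)
qed

text \<open>The basic one-step inequality. The factor \<open>4 \<beta> / \<mu>\<close> consists of the \<open>\<beta> / \<mu>\<close> from the coupling part and
  the \<open>3 \<beta> / \<mu>\<close> from the absorbed error terms; it is smaller than the \<open>5 \<beta> / \<mu>\<close> that the lower bound on the
  contraction factors \<open>\<kappa>\<close> of the variance recursion provides.\<close>

lemma potential_step:
  assumes zero: "b * (norm (S k))\<^sup>2 \<le> S k \<bullet> (u k - z)"
  shows "potential (Suc k) z (S (Suc k)) (u (Suc k)) (s (Suc k)) + (2 - 3 * \<mu>) * \<beta> * \<tau> k * (norm (S k))\<^sup>2
      + margin * weight (Suc k) * (norm (S (Suc k) - S k))\<^sup>2 + weight (Suc k) * (\<Lambda> * E (Suc k))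
    \<le> (1 + growth / weight (Suc k)) * potential k z (S k) (u k) (s k)
      + 4 * \<beta> / \<mu> * weight (Suc k) * (norm (e k))\<^sup>2"
proof -
  have "0 \<le> b * (norm (S k))\<^sup>2" using b_gt(2) \<beta>(1) by simp
  then have "0 \<le> S k \<bullet> (u k - z)" using zero by linarith
  from anchor_step[OF \<mu> gain_pos gain_le s_Suc refl this]
  have anchor: "(1 - \<mu>) / (\<mu> * gain k) * (norm (s (Suc k) - z))\<^sup>2 + (1 - \<mu>) * (S k \<bullet> (s k - u k))
    \<le> (1 - \<mu>) / (\<mu> * gain k) * (norm (s k - z))\<^sup>2 + norm (e k) * norm (s k - z)
      + \<mu> * \<beta> * (norm (S k))\<^sup>2 + \<mu> * \<beta> * (norm (e k))\<^sup>2" .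
  have mono: "(1 - \<mu>) / (\<mu> * gain (Suc k)) * (norm (s (Suc k) - z))\<^sup>2
    \<le> (1 - \<mu>) / (\<mu> * gain k) * (norm (s (Suc k) - z))\<^sup>2"
    by (intro mult_right_mono anchor_coefficient) simp
  have pot: "potential j z (S j) (u j) (s j) = coupling j + (1 - \<mu>) / (\<mu> * gain j) * (norm (s j - z))\<^sup>2" for j
    by (simp add: potential_def coupling_def)
  have split: "(2 * \<beta> + \<mu> * \<beta>) * (norm (S k))\<^sup>2 = 2 * \<beta> * (norm (S k))\<^sup>2 + \<mu> * \<beta> * (norm (S k))\<^sup>2"
    by (simp add: algebra_simps)
  have "4 * \<beta> / \<mu> * weight (Suc k) * (norm (e k))\<^sup>2
      = \<beta> / \<mu> * weight (Suc k) * (norm (e k))\<^sup>2 + 3 * \<beta> / \<mu> * weight (Suc k) * (norm (e k))\<^sup>2"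
    by (simp add: algebra_simps add_divide_distrib)
  moreover have "(1 + growth / weight (Suc k)) * potential k z (S k) (u k) (s k)
      = potential k z (S k) (u k) (s k) + growth / weight (Suc k) * potential k z (S k) (u k) (s k)"
    by (simp add: distrib_right)
  ultimately show ?thesis
    using coupling_step[of k] anchor mono error_absorption[OF zero, of k "e k" "s k"] split
    unfolding pot by linarith
qed

end

text \<open>A realisation whose estimation errors are summable with the quadratic weights, and a zero \<open>z\<close> of
  the residual, of which only the cocoercivity inequality is recorded. All limits below are
  deterministic consequences.\<close>

locale vfosa_convergent_trajectory = vfosa_trajectory +
  fixes z
  assumes zero: "b * (norm (S k))\<^sup>2 \<le> S k \<bullet> (u k - z)"
    and errors: "summable (\<lambda>k. weight (Suc k) * (norm (e k))\<^sup>2)"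
begin

lemma potential_converges:
  "convergent (\<lambda>k. potential k z (S k) (u k) (s k))"
  and summable_\<tau>_residual: "summable (\<lambda>k. \<tau> k * (norm (S k))\<^sup>2)"
proof -
  let ?V = "\<lambda>k. potential k z (S k) (u k) (s k)"
  let ?c = "\<lambda>k. (2 - 3 * \<mu>) * \<beta> * \<tau> k * (norm (S k))\<^sup>2"
  let ?g = "\<lambda>k. 4 * \<beta> / \<mu> * weight (Suc k) * (norm (e k))\<^sup>2"
  let ?q = "\<lambda>k. growth / weight (Suc k)"
  have nonneg: "0 \<le> ?V k" "0 \<le> ?c k" "0 \<le> ?g k" "0 \<le> ?q k" for k
    using potential_nonneg[OF zero] \<mu> \<beta>(1) \<tau>_pos[of k] weight_pos[of "Suc k"] growth_nonneg
    by (auto intro!: mult_nonneg_nonneg)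
  have step: "?V (Suc k) + ?c k \<le> (1 + ?q k) * ?V k + ?g k" for k
  proof -
    have "0 \<le> margin * weight (Suc k) * (norm (S (Suc k) - S k))\<^sup>2" "0 \<le> weight (Suc k) * (\<Lambda> * E (Suc k))"
      using margin_pos weight_pos[of "Suc k"] \<Lambda> E_nonneg by (auto intro!: mult_nonneg_nonneg)
    then show ?thesis using potential_step[OF zero, of k] by linarith
  qed
  have g: "summable ?g" using summable_mult[OF errors, of "4 * \<beta> / \<mu>"] by (simp add: mult.assoc)
  note conv = almost_supermartingale_sequence[OF nonneg step summable_inverse_weight g]
  show "convergent ?V" by (rule conv(1))
  have "?c = (\<lambda>k. ((2 - 3 * \<mu>) * \<beta>) * (\<tau> k * (norm (S k))\<^sup>2))" by (simp add: mult.assoc)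
  then show "summable (\<lambda>k. \<tau> k * (norm (S k))\<^sup>2)"
    using conv(2) \<mu> \<beta> by (simp add: summable_cmult_iff)
qed

lemma summable_\<tau>_error: "summable (\<lambda>k. \<tau> k * (norm (e k))\<^sup>2)"
proof (rule summable_comparison_test'[where N = 0])
  show "summable (\<lambda>k. 1 / (2 * \<mu>) * (weight (Suc k) * (norm (e k))\<^sup>2))"
    by (intro summable_mult errors)
  fix k
  have "\<tau> k * (2 * \<mu>) \<le> \<tau> k * (\<tau> k - 1)"
    using \<tau>_bounds(1)[of k] \<tau>_pos[of k] by (intro mult_left_mono) auto
  then have "\<tau> k \<le> 1 / (2 * \<mu>) * weight (Suc k)"
    using \<mu> by (simp add: weight_Suc pos_le_divide_eq)
  then have "\<tau> k * (norm (e k))\<^sup>2 \<le> 1 / (2 * \<mu>) * weight (Suc k) * (norm (e k))\<^sup>2"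
    by (rule mult_right_mono) simp
  then show "norm (\<tau> k * (norm (e k))\<^sup>2) \<le> 1 / (2 * \<mu>) * (weight (Suc k) * (norm (e k))\<^sup>2)"
    using \<tau>_pos[of k] by (simp add: mult.assoc)
qed

lemma summable_\<tau>_noisy: "summable (\<lambda>k. \<tau> k * (norm (S k + e k))\<^sup>2)"
proof (rule summable_comparison_test'[where N = 0])
  show "summable (\<lambda>k. 2 * (\<tau> k * (norm (S k))\<^sup>2) + 2 * (\<tau> k * (norm (e k))\<^sup>2))"
    by (intro summable_add summable_mult summable_\<tau>_residual summable_\<tau>_error)
  fix k
  have "\<tau> k * (norm (S k + e k))\<^sup>2 \<le> \<tau> k * (2 * (norm (S k))\<^sup>2 + 2 * (norm (e k))\<^sup>2)"
    using \<tau>_pos[of k] by (intro mult_left_mono norm_add_sq_le) auto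
  then show "norm (\<tau> k * (norm (S k + e k))\<^sup>2) \<le> 2 * (\<tau> k * (norm (S k))\<^sup>2) + 2 * (\<tau> k * (norm (e k))\<^sup>2)"
    using \<tau>_pos[of k] by (simp add: algebra_simps)
qed

text \<open>The new gap is a convex combination of the old gap and a vector of order
  \<open>\<tau> k * \<parallel>S + e\<parallel>\<close>, so convexity of the square applies.\<close>

lemma gap_contraction:
  "(norm (s (Suc k) - u (Suc k)))\<^sup>2 + 1 / \<tau> k * (norm (s k - u k))\<^sup>2
    \<le> (norm (s k - u k))\<^sup>2 + 4 * \<beta>\<^sup>2 * (\<tau> k * (norm (S k + e k))\<^sup>2)"
proof -
  define p where "p = 1 / \<tau> k"
  define w where "w = s k - u k"
  define y where "y = ((1 - \<mu> / 2) * gain k * \<tau> k) *\<^sub>R (S k + e k)"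
  have p: "0 < p" "p < 1" "p * \<tau> k = 1"
    using \<tau>_bounds(1)[of k] \<mu> \<tau>_pos[of k] by (auto simp: p_def)
  have eq: "s (Suc k) - u (Suc k) = (1 - p) *\<^sub>R w + p *\<^sub>R y"
    unfolding gap_Suc w_def y_def using p(3) by (simp add: p_def[symmetric] mult.commute)
  have "(norm ((1 - p) *\<^sub>R w + p *\<^sub>R y))\<^sup>2 + p * (1 - p) * (norm (w - y))\<^sup>2 = (1 - p) * (norm w)\<^sup>2 + p * (norm y)\<^sup>2"
    unfolding power2_norm_eq_inner
    by (simp add: inner_diff_left inner_diff_right inner_add_left inner_add_right inner_commute algebra_simps)
  moreover have "0 \<le> p * (1 - p) * (norm (w - y))\<^sup>2" using p by simp
  moreover have "p * (norm y)\<^sup>2 \<le> 4 * \<beta>\<^sup>2 * (\<tau> k * (norm (S k + e k))\<^sup>2)"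
  proof -
    have "(1 - \<mu> / 2) * gain k \<le> 1 * (2 * \<beta>)"
      using gain_le[of k] gain_pos[of k] \<mu> by (intro mult_mono) auto
    then have "((1 - \<mu> / 2) * gain k)\<^sup>2 \<le> (2 * \<beta>)\<^sup>2"
      using gain_pos[of k] \<mu> by (intro power_mono) auto
    then have "((1 - \<mu> / 2) * gain k)\<^sup>2 * (\<tau> k * (norm (S k + e k))\<^sup>2) \<le> (2 * \<beta>)\<^sup>2 * (\<tau> k * (norm (S k + e k))\<^sup>2)"
      using \<tau>_pos[of k] by (intro mult_right_mono) auto
    moreover have "(norm y)\<^sup>2 = ((1 - \<mu> / 2) * gain k)\<^sup>2 * (\<tau> k)\<^sup>2 * (norm (S k + e k))\<^sup>2"
      unfolding y_def norm_scaleR power_mult_distrib power2_abs by (rule refl)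
    then have "p * (norm y)\<^sup>2 = ((1 - \<mu> / 2) * gain k)\<^sup>2 * (\<tau> k * (norm (S k + e k))\<^sup>2)"
      using \<tau>_pos[of k] by (simp add: p_def power2_eq_square[of "\<tau> k"])
    ultimately show ?thesis by (simp add: power_mult_distrib)
  qed
  ultimately show ?thesis
    unfolding eq p_def[symmetric] w_def[symmetric] by (simp add: algebra_simps)
qed

text \<open>The squared gaps converge and are summable against \<open>1 / \<tau> k\<close>, which is of the order of the harmonic
  series; hence their limit is zero.\<close>

lemma summable_gap: "summable (\<lambda>k. 1 / \<tau> k * (norm (s k - u k))\<^sup>2)"
  and gap_tendsto: "(\<lambda>k. s k - u k) \<longlonglongrightarrow> 0"
proof -
  let ?h = "\<lambda>k. (norm (s k - u k))\<^sup>2"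
  let ?g = "\<lambda>k. 4 * \<beta>\<^sup>2 * (\<tau> k * (norm (S k + e k))\<^sup>2)"
  have nonneg: "0 \<le> ?h k" "0 \<le> 1 / \<tau> k * ?h k" "0 \<le> ?g k" "0 \<le> (0::real)" for k
    using \<tau>_pos[of k] by auto
  have step: "?h (Suc k) + 1 / \<tau> k * ?h k \<le> (1 + 0) * ?h k + ?g k" for k
    using gap_contraction[of k] by simp
  note conv = almost_supermartingale_sequence[OF nonneg step summable_zero summable_mult[OF summable_\<tau>_noisy]]
  show "summable (\<lambda>k. 1 / \<tau> k * ?h k)" by (rule conv(2))
  then have "summable (\<lambda>k. \<mu> * r * (1 / \<tau> k * ?h k))" by (rule summable_mult)
  moreover have "norm (?h k / (real k + 1)) \<le> \<mu> * r * (1 / \<tau> k * ?h k)" for k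
  proof -
    have "?h k * \<tau> k \<le> ?h k * (\<mu> * r * (real k + 1))" using \<tau>_le[of k] by (intro mult_left_mono) auto
    then show ?thesis using \<tau>_pos[of k] by (simp add: field_simps)
  qed
  ultimately have "summable (\<lambda>k. ?h k / (real k + 1))"
    by (rule summable_comparison_test'[where N = 0])
  from limit_zero_if_harmonically_summable[OF nonneg(1) conv(1) this]
  have "?h \<longlonglongrightarrow> 0" .
  then have "(\<lambda>k. sqrt (?h k)) \<longlonglongrightarrow> sqrt 0" by (rule tendsto_real_sqrt)
  then show "(\<lambda>k. s k - u k) \<longlonglongrightarrow> 0" by (simp add: tendsto_norm_zero_iff)
qed

lemma increment_sq_le:
  "(norm (u (Suc k) - u k))\<^sup>2 \<le> 2 * ((1 / \<tau> k)\<^sup>2 * (norm (s k - u k))\<^sup>2) + 8 * \<beta>\<^sup>2 * (norm (S k + e k))\<^sup>2"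
proof -
  have eq: "u (Suc k) - u k = (1 / \<tau> k) *\<^sub>R (s k - u k) + (- gain k) *\<^sub>R (S k + e k)"
    by (simp add: u_Suc)
  have "(gain k)\<^sup>2 \<le> (2 * \<beta>)\<^sup>2" using gain_le[of k] gain_pos[of k] by (intro power_mono) auto
  then have "(gain k)\<^sup>2 * (norm (S k + e k))\<^sup>2 \<le> (2 * \<beta>)\<^sup>2 * (norm (S k + e k))\<^sup>2"
    by (intro mult_right_mono) auto
  then show ?thesis
    unfolding eq using norm_add_sq_le[of "(1 / \<tau> k) *\<^sub>R (s k - u k)" "(- gain k) *\<^sub>R (S k + e k)"]
    by (simp add: power_mult_distrib power_divide)
qed

lemma summable_\<tau>_increment: "summable (\<lambda>k. \<tau> k * (norm (u (Suc k) - u k))\<^sup>2)"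
proof (rule summable_comparison_test'[where N = 0])
  show "summable (\<lambda>k. 2 * (1 / \<tau> k * (norm (s k - u k))\<^sup>2) + 8 * \<beta>\<^sup>2 * (\<tau> k * (norm (S k + e k))\<^sup>2))"
    by (intro summable_add summable_mult summable_gap summable_\<tau>_noisy)
  fix k
  have "\<tau> k * (norm (u (Suc k) - u k))\<^sup>2
      \<le> \<tau> k * (2 * ((1 / \<tau> k)\<^sup>2 * (norm (s k - u k))\<^sup>2) + 8 * \<beta>\<^sup>2 * (norm (S k + e k))\<^sup>2)"
    using \<tau>_pos[of k] by (intro mult_left_mono increment_sq_le) auto
  also have "\<dots> = 2 * (1 / \<tau> k * (norm (s k - u k))\<^sup>2) + 8 * \<beta>\<^sup>2 * (\<tau> k * (norm (S k + e k))\<^sup>2)"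
    using \<tau>_pos[of k] by (simp add: distrib_left power2_eq_square)
  finally show "norm (\<tau> k * (norm (u (Suc k) - u k))\<^sup>2)
      \<le> 2 * (1 / \<tau> k * (norm (s k - u k))\<^sup>2) + 8 * \<beta>\<^sup>2 * (\<tau> k * (norm (S k + e k))\<^sup>2)"
    using \<tau>_pos[of k] by simp
qed

lemma summable_linear_weight:
  assumes "summable (\<lambda>k. \<tau> k * h k)" "\<And>k. 0 \<le> h k"
  shows "summable (\<lambda>k. (real k + 1) * h k)"
proof (rule summable_comparison_test'[where N = 0])
  show "summable (\<lambda>k. 1 / \<mu> * (\<tau> k * h k))" by (intro summable_mult assms)
  fix k
  have "\<mu> * (real k + 1) * h k \<le> \<tau> k * h k"
    using \<tau>_bounds(2)[of k] assms(2) by (intro mult_right_mono) auto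
  then show "norm ((real k + 1) * h k) \<le> 1 / \<mu> * (\<tau> k * h k)"
    using \<mu> assms(2)[of k] by (simp add: pos_le_divide_eq mult.commute mult.left_commute)
qed

lemma summable_squared_error: "summable (\<lambda>k. (real k + 1)\<^sup>2 * (norm (e k))\<^sup>2)"
proof (rule summable_comparison_test'[where N = 0])
  show "summable (\<lambda>k. 1 / \<mu>\<^sup>2 * (weight (Suc k) * (norm (e k))\<^sup>2))" by (intro summable_mult errors)
  fix k
  have "\<mu>\<^sup>2 * (real k + 1)\<^sup>2 \<le> \<mu>\<^sup>2 * (real (Suc k) + 1)\<^sup>2"
    by (intro mult_left_mono power_mono) auto
  also have "\<dots> \<le> weight (Suc k)" by (rule weight_ge)
  finally have "\<mu>\<^sup>2 * (real k + 1)\<^sup>2 * (norm (e k))\<^sup>2 \<le> weight (Suc k) * (norm (e k))\<^sup>2"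
    by (rule mult_right_mono) simp
  then show "norm ((real k + 1)\<^sup>2 * (norm (e k))\<^sup>2) \<le> 1 / \<mu>\<^sup>2 * (weight (Suc k) * (norm (e k))\<^sup>2)"
    using \<mu> by (simp add: pos_le_divide_eq mult.commute mult.left_commute)
qed

lemma cross_term_tendsto: "(\<lambda>k. (\<tau> k - \<mu>) * (S k \<bullet> (s k - u k))) \<longlonglongrightarrow> 0"
proof -
  obtain K where K: "\<And>k. norm (potential k z (S k) (u k) (s k)) \<le> K"
    using convergent_imp_Bseq[OF potential_converges] by (auto simp: Bseq_def)
  define B where "B = sqrt (K / \<delta>)"
  have X: "(\<tau> k - \<mu>) * norm (S k) \<le> B" for k
  proof -
    have "\<delta> * ((\<tau> k - \<mu>) * norm (S k))\<^sup>2
       \<le> \<delta> * (((\<tau> k - \<mu>) * norm (S k))\<^sup>2 + (norm (s k - z))\<^sup>2)"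
      using \<delta>_pos by (intro mult_left_mono) auto
    also have "\<dots> \<le> K"
      using potential_coercive[OF zero, of k k "s k"] K[of k] by simp
    finally have "((\<tau> k - \<mu>) * norm (S k))\<^sup>2 \<le> K / \<delta>"
      using \<delta>_pos by (simp add: pos_le_divide_eq mult.commute)
    then show ?thesis unfolding B_def by (rule real_le_rsqrt)
  qed
  have "(\<lambda>k. B * norm (s k - u k)) \<longlonglongrightarrow> 0"
    using tendsto_mult_left[OF tendsto_norm_zero[OF gap_tendsto], of B] by simp
  moreover have "norm ((\<tau> k - \<mu>) * (S k \<bullet> (s k - u k))) \<le> B * norm (s k - u k)" for k
  proof -
    have t: "0 \<le> \<tau> k - \<mu>" using \<tau>_bounds(1)[of k] \<mu> by simp
    have "norm ((\<tau> k - \<mu>) * (S k \<bullet> (s k - u k))) \<le> (\<tau> k - \<mu>) * (norm (S k) * norm (s k - u k))"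
      using t Cauchy_Schwarz_ineq2[of "S k" "s k - u k"] by (simp add: abs_mult mult_left_mono)
    also have "\<dots> \<le> B * norm (s k - u k)"
      unfolding mult.assoc[symmetric] using X by (intro mult_right_mono) auto
    finally show ?thesis .
  qed
  ultimately show ?thesis
    by (rule Lim_null_comparison[OF always_eventually, OF allI, rotated])
qed

text \<open>The leftover \<open>(1 - \<mu>) \<langle>S, w\<rangle>\<close> is absolutely summable, because \<open>\<tau> \<parallel>S\<parallel>\<^sup>2\<close> and \<open>\<parallel>w\<parallel>\<^sup>2 / \<tau>\<close> are. Therefore
  the coupling part is almost monotone by itself.\<close>

lemma coupling_converges: "convergent coupling"
proof -
  let ?g = "\<lambda>k. (1 + 3 * \<beta>) * (\<tau> k * (norm (S k))\<^sup>2) + 1 / \<tau> k * (norm (s k - u k))\<^sup>2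
     + \<beta> / \<mu> * (weight (Suc k) * (norm (e k))\<^sup>2) + \<beta> * (\<tau> k * (norm (e k))\<^sup>2)"
  obtain K where K: "\<And>k. norm ((\<tau> k - \<mu>) * (S k \<bullet> (s k - u k))) \<le> K"
    using convergent_imp_Bseq[OF convergentI[OF cross_term_tendsto]] by (auto simp: Bseq_def)
  have "- K \<le> coupling k" for k
  proof -
    have "0 \<le> \<beta> * weight k * (norm (S k))\<^sup>2" using \<beta>(1) weight_pos[of k] by simp
    then show ?thesis using K[of k] by (simp add: coupling_def)
  qed
  moreover have "coupling (Suc k) \<le> coupling k + ?g k" for k
  proof -
    let ?n = "norm (S k)" and ?w = "norm (s k - u k)" and ?q = "norm (e k)"
    have t: "1 \<le> \<tau> k" using \<tau>_bounds(1)[of k] \<mu> by simp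
    have drop: "0 \<le> (2 - 3 * \<mu>) * \<beta> * \<tau> k * ?n\<^sup>2" "0 \<le> margin * weight (Suc k) * (norm (S (Suc k) - S k))\<^sup>2"
      "0 \<le> weight (Suc k) * (\<Lambda> * E (Suc k))"
      using margin_pos weight_pos[of "Suc k"] \<Lambda> E_nonneg \<mu> \<beta>(1) t by (auto intro!: mult_nonneg_nonneg)
    have "\<bar>(1 - \<mu>) * (S k \<bullet> (s k - u k))\<bar> \<le> 1 * (?n * ?w)"
      unfolding abs_mult using \<mu> Cauchy_Schwarz_ineq2 by (intro mult_mono) auto
    moreover have "?n * ?w \<le> \<tau> k * ?n\<^sup>2 + 1 / (4 * \<tau> k) * ?w\<^sup>2"
      using t by (intro weighted_young) auto
    moreover have "1 / (4 * \<tau> k) * ?w\<^sup>2 \<le> 1 / \<tau> k * ?w\<^sup>2"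
      using t by (intro mult_right_mono divide_left_mono) auto
    moreover have "2 * \<beta> * ?n\<^sup>2 \<le> 2 * \<beta> * (\<tau> k * ?n\<^sup>2)"
      using t \<beta>(1) mult_right_mono[of 1 "\<tau> k" "?n\<^sup>2"] by simp
    moreover have "2 * \<beta> * \<tau> k * (?n * ?q) \<le> \<beta> * (\<tau> k * ?n\<^sup>2) + \<beta> * (\<tau> k * ?q\<^sup>2)"
    proof -
      have "0 \<le> \<beta> * \<tau> k * (?n - ?q)\<^sup>2" using t \<beta>(1) by simp
      also have "\<dots> = \<beta> * (\<tau> k * ?n\<^sup>2) + \<beta> * (\<tau> k * ?q\<^sup>2) - 2 * \<beta> * \<tau> k * (?n * ?q)"
        by (simp add: power2_eq_square algebra_simps)
      finally show ?thesis by simp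
    qed
    moreover have "(1 + 3 * \<beta>) * (\<tau> k * ?n\<^sup>2) = \<tau> k * ?n\<^sup>2 + 2 * \<beta> * (\<tau> k * ?n\<^sup>2) + \<beta> * (\<tau> k * ?n\<^sup>2)"
      by (simp add: algebra_simps)
    moreover have "\<beta> / \<mu> * weight (Suc k) * ?q\<^sup>2 = \<beta> / \<mu> * (weight (Suc k) * ?q\<^sup>2)" by simp
    ultimately show ?thesis using coupling_step[of k] drop by linarith
  qed
  moreover have "summable ?g"
    by (intro summable_add summable_mult summable_\<tau>_residual summable_gap errors summable_\<tau>_error)
  ultimately show ?thesis by (rule almost_monotone_convergent)
qed

text \<open>The coupling part and its cross term converge, so \<open>weight k * \<parallel>S\<parallel>\<^sup>2\<close> converges; as \<open>k \<parallel>S\<parallel>\<^sup>2\<close> is summable,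
  the limit is zero.\<close>

lemma residual_rate: "(\<lambda>k. (real k + 1)\<^sup>2 * (norm (S k))\<^sup>2) \<longlonglongrightarrow> 0"
proof -
  let ?h = "\<lambda>k. \<beta> * weight k * (norm (S k))\<^sup>2"
  have h0: "0 \<le> ?h k" for k using \<beta>(1) weight_pos[of k] by simp
  have "?h = (\<lambda>k. coupling k + (\<tau> k - \<mu>) * (S k \<bullet> (s k - u k)))"
    by (simp add: coupling_def)
  moreover have "convergent (\<lambda>k. coupling k + (\<tau> k - \<mu>) * (S k \<bullet> (s k - u k)))"
    by (intro convergent_add coupling_converges convergentI[OF cross_term_tendsto])
  ultimately have "convergent ?h" by simp
  moreover have "summable (\<lambda>k. ?h k / (real k + 1))"
  proof (rule summable_comparison_test'[where N = 0])
    show "summable (\<lambda>k. \<beta> * (\<mu> * r)\<^sup>2 * ((real k + 1) * (norm (S k))\<^sup>2))"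
      by (intro summable_mult summable_linear_weight summable_\<tau>_residual) simp
    fix k
    have "?h k \<le> \<beta> * (\<mu> * r * (real k + 1))\<^sup>2 * (norm (S k))\<^sup>2"
      using weight_le \<beta>(1) by (intro mult_right_mono mult_left_mono) auto
    then have "?h k / (real k + 1) \<le> \<beta> * (\<mu> * r * (real k + 1))\<^sup>2 * (norm (S k))\<^sup>2 / (real k + 1)"
      by (intro divide_right_mono) auto
    also have "\<dots> = \<beta> * (\<mu> * r)\<^sup>2 * ((real k + 1) * (norm (S k))\<^sup>2)"
      by (simp add: power2_eq_square)
    finally show "norm (?h k / (real k + 1)) \<le> \<beta> * (\<mu> * r)\<^sup>2 * ((real k + 1) * (norm (S k))\<^sup>2)"
      using h0[of k] by simp
  qed
  ultimately have lim: "?h \<longlonglongrightarrow> 0" using h0 by (intro limit_zero_if_harmonically_summable)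
  have "(\<lambda>k. 1 / (\<beta> * \<mu>\<^sup>2) * ?h k) \<longlonglongrightarrow> 0"
    using tendsto_mult_left[OF lim, of "1 / (\<beta> * \<mu>\<^sup>2)"] by simp
  moreover have "norm ((real k + 1)\<^sup>2 * (norm (S k))\<^sup>2) \<le> 1 / (\<beta> * \<mu>\<^sup>2) * ?h k" for k
  proof -
    have "\<mu>\<^sup>2 * (real k + 1)\<^sup>2 * (norm (S k))\<^sup>2 \<le> weight k * (norm (S k))\<^sup>2"
      using weight_ge by (intro mult_right_mono) auto
    then show ?thesis using \<mu> \<beta>(1) by (simp add: pos_le_divide_eq mult.commute mult.left_commute)
  qed
  ultimately show ?thesis
    by (rule Lim_null_comparison[OF always_eventually, OF allI, rotated])
qed

lemma increment_rate: "(\<lambda>k. (real k + 1)\<^sup>2 * (norm (u (Suc k) - u k))\<^sup>2) \<longlonglongrightarrow> 0"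
proof -
  let ?b = "\<lambda>k. 2 / \<mu>\<^sup>2 * (norm (s k - u k))\<^sup>2 + 16 * \<beta>\<^sup>2 * ((real k + 1)\<^sup>2 * (norm (S k))\<^sup>2)
     + 16 * \<beta>\<^sup>2 * ((real k + 1)\<^sup>2 * (norm (e k))\<^sup>2)"
  have "?b \<longlonglongrightarrow> 2 / \<mu>\<^sup>2 * (norm (0::'a))\<^sup>2 + 16 * \<beta>\<^sup>2 * 0 + 16 * \<beta>\<^sup>2 * 0"
    by (intro tendsto_intros gap_tendsto residual_rate summable_LIMSEQ_zero[OF summable_squared_error])
  then have "?b \<longlonglongrightarrow> 0" by simp
  moreover have "norm ((real k + 1)\<^sup>2 * (norm (u (Suc k) - u k))\<^sup>2) \<le> ?b k" for k
  proof -
    let ?m = "(real k + 1)\<^sup>2" and ?w = "(norm (s k - u k))\<^sup>2"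
    have "?m * (norm (u (Suc k) - u k))\<^sup>2
      \<le> ?m * (2 * ((1 / \<tau> k)\<^sup>2 * ?w) + 8 * \<beta>\<^sup>2 * (2 * (norm (S k))\<^sup>2 + 2 * (norm (e k))\<^sup>2))"
      using increment_sq_le[of k] mult_left_mono[OF norm_add_sq_le[of "S k" "e k"], of "8 * \<beta>\<^sup>2"]
      by (intro mult_left_mono) auto
    moreover have "?m * ((1 / \<tau> k)\<^sup>2 * ?w) \<le> 1 / \<mu>\<^sup>2 * ?w"
    proof -
      have "(real k + 1) * (1 / \<tau> k) \<le> 1 / \<mu>"
        using \<tau>_bounds(2)[of k] \<tau>_pos[of k] \<mu> by (simp add: divide_simps mult.commute)
      then have "((real k + 1) * (1 / \<tau> k))\<^sup>2 \<le> (1 / \<mu>)\<^sup>2"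
        using \<tau>_pos[of k] by (intro power_mono) auto
      then have "?m * (1 / \<tau> k)\<^sup>2 \<le> 1 / \<mu>\<^sup>2"
        unfolding power_mult_distrib by (simp only: power_one_over)
      then have "?m * (1 / \<tau> k)\<^sup>2 * ?w \<le> 1 / \<mu>\<^sup>2 * ?w" by (rule mult_right_mono) simp
      then show ?thesis by (simp add: mult.assoc)
    qed
    ultimately show ?thesis by (simp add: algebra_simps)
  qed
  ultimately show ?thesis
    by (rule Lim_null_comparison[OF always_eventually, OF allI, rotated])
qed

text \<open>The potential minus its coupling part is the squared distance of the anchor to \<open>z\<close>, up to a
  convergent factor, and the gap between anchor and iterate vanishes.\<close>

lemma distance_converges: "convergent (\<lambda>k. norm (u k - z))"
proof -
  have inc: "incseq gain" using gain_mono by (rule incseq_SucI)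
  obtain g where g: "gain \<longlonglongrightarrow> g"
  proof (rule incseq_convergent[OF inc allI[OF gain_le]])
    fix L assume "gain \<longlonglongrightarrow> L" then show thesis by (rule that)
  qed
  obtain p where p: "(\<lambda>k. potential k z (S k) (u k) (s k)) \<longlonglongrightarrow> p"
    using potential_converges by (auto simp: convergent_def)
  obtain c where c: "coupling \<longlonglongrightarrow> c"
    using coupling_converges by (auto simp: convergent_def)
  have sq: "(\<lambda>k. (norm (s k - z))\<^sup>2) = (\<lambda>k. (potential k z (S k) (u k) (s k) - coupling k) * (\<mu> * gain k / (1 - \<mu>)))"
  proof
    fix k
    have nz: "\<mu> * gain k \<noteq> 0" "1 - \<mu> \<noteq> 0" using \<mu> gain_pos[of k] by auto
    have cancel: "N = (1 - \<mu>) / q * N * (q / (1 - \<mu>))" if "q \<noteq> 0" for N q :: real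
      using that nz(2) by (simp add: divide_simps)
    have diff: "potential k z (S k) (u k) (s k) - coupling k = (1 - \<mu>) / (\<mu> * gain k) * (norm (s k - z))\<^sup>2"
      unfolding potential_def coupling_def by (rule add_diff_cancel_left')
    show "(norm (s k - z))\<^sup>2 = (potential k z (S k) (u k) (s k) - coupling k) * (\<mu> * gain k / (1 - \<mu>))"
      unfolding diff by (rule cancel[OF nz(1)])
  qed
  have "(\<lambda>k. (norm (s k - z))\<^sup>2) \<longlonglongrightarrow> (p - c) * (\<mu> * g / (1 - \<mu>))"
    unfolding sq
    by (rule tendsto_mult[OF tendsto_diff[OF p c] tendsto_divide[OF tendsto_mult[OF tendsto_const g] tendsto_const]])
       (use \<mu> in simp)
  then obtain l where "(\<lambda>k. (norm (s k - z))\<^sup>2) \<longlonglongrightarrow> l" by (auto simp: convergent_def)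
  then have "(\<lambda>k. sqrt ((norm (s k - z))\<^sup>2)) \<longlonglongrightarrow> sqrt l" by (rule tendsto_real_sqrt)
  then have l: "(\<lambda>k. norm (s k - z)) \<longlonglongrightarrow> sqrt l" by simp
  have close: "norm (norm (u k - z) - norm (s k - z)) \<le> norm (s k - u k)" for k
    using norm_triangle_ineq3[of "u k - z" "s k - z"] by (simp add: norm_minus_commute)
  have "(\<lambda>k. norm (u k - z) - norm (s k - z)) \<longlonglongrightarrow> 0"
    by (rule Lim_null_comparison[OF always_eventually[OF allI[OF close]] tendsto_norm_zero[OF gap_tendsto]])
  from tendsto_add[OF this l] show ?thesis by (auto simp: convergent_def)
qed

end

section \<open>Variance reduction in expectation\<close>

lemma nn_integral_nn_cond_exp:
  assumes "finite_measure M" "subalgebra M N" "f \<in> borel_measurable M"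
  shows "(\<integral>\<^sup>+\<omega>. nn_cond_exp M N f \<omega> \<partial>M) = (\<integral>\<^sup>+\<omega>. f \<omega> \<partial>M)"
proof -
  interpret finite_measure_subalgebra M N
    using assms by (simp add: finite_measure_subalgebra_def finite_measure_subalgebra_axioms_def)
  show ?thesis using nn_cond_exp_intg[of "\<lambda>_. 1" f] assms by simp
qed

lemma AE_summable_if_expectations_summable:
  fixes f :: "nat \<Rightarrow> 'w \<Rightarrow> real"
  assumes [measurable]: "\<And>k. f k \<in> borel_measurable M" and f: "\<And>k \<omega>. \<omega> \<in> space M \<Longrightarrow> 0 \<le> f k \<omega>"
    and bound: "\<And>k. (\<integral>\<^sup>+\<omega>. ennreal (f k \<omega>) \<partial>M) \<le> ennreal (c k)" and c: "summable c" "\<And>k. 0 \<le> c k"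
  shows "AE \<omega> in M. summable (\<lambda>k. f k \<omega>)"
proof -
  have "(\<integral>\<^sup>+\<omega>. (\<Sum>k. ennreal (f k \<omega>)) \<partial>M) = (\<Sum>k. \<integral>\<^sup>+\<omega>. ennreal (f k \<omega>) \<partial>M)"
    by (intro nn_integral_suminf) measurable
  also have "\<dots> \<le> (\<Sum>k. ennreal (c k))"
    by (intro suminf_le bound) auto
  also have "\<dots> = ennreal (suminf c)"
    using c by (intro suminf_ennreal2) auto
  finally have "(\<integral>\<^sup>+\<omega>. (\<Sum>k. ennreal (f k \<omega>)) \<partial>M) \<noteq> \<infinity>"
    by (auto simp: top_unique)
  then have "AE \<omega> in M. (\<Sum>k. ennreal (f k \<omega>)) \<noteq> \<infinity>"
    by (intro nn_integral_PInf_AE) auto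
  then show ?thesis
  proof (rule AE_mp, intro AE_I2 impI)
    fix \<omega> assume "\<omega> \<in> space M" "(\<Sum>k. ennreal (f k \<omega>)) \<noteq> \<infinity>"
    then show "summable (\<lambda>k. f k \<omega>)"
      using f by (intro summable_suminf_not_top) auto
  qed
qed

text \<open>The errors are summable almost surely because their expectations are. Taking expectations in the
  one-step inequality and in the variance recursion, and adding the two, gives an almost
  supermartingale for \<open>Q k = \<integral>V k + g k * \<integral>\<Delta> k\<close>: the surplus \<open>\<Lambda> * E\<close> of the former pays for the term
  \<open>\<Theta> * E\<close> of the latter, and the gap between \<open>g (Suc k) * (1 - \<kappa> (Suc k))\<close> and \<open>g k\<close> pays for the errors
  with \<open>c * a k * \<integral>\<Delta> k\<close> to spare.

  The integrals have values in \<open>[0, \<infinity>]\<close>, and their finiteness comes out of the recursion. The two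
  inequalities are added before integrating: this eliminates \<open>E\<close> pointwise, so that only \<open>V\<close>, \<open>\<Delta>\<close> and
  the errors are integrated.\<close>

lemma variance_reduction_errors_summable:
  fixes V \<Delta> err E :: "nat \<Rightarrow> 'w \<Rightarrow> real" and a g q \<kappa> \<Theta> \<sigma> :: "nat \<Rightarrow> real" and \<Lambda> C c :: real
  assumes M: "prob_space M" and Fil: "\<And>k. subalgebra M (Fil k)"
    and meas [measurable]: "\<And>k. V k \<in> borel_measurable M" "\<And>k. \<Delta> k \<in> borel_measurable M"
      "\<And>k. err k \<in> borel_measurable M"
    and nonneg: "\<And>k \<omega>. \<omega> \<in> space M \<Longrightarrow> 0 \<le> V k \<omega>" "\<And>k \<omega>. \<omega> \<in> space M \<Longrightarrow> 0 \<le> \<Delta> k \<omega>"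
      "\<And>k \<omega>. \<omega> \<in> space M \<Longrightarrow> 0 \<le> err k \<omega>" "\<And>k \<omega>. 0 \<le> E k \<omega>"
    and start: "(\<integral>\<^sup>+\<omega>. ennreal (V 0 \<omega>) \<partial>M) < \<infinity>" "\<And>\<omega>. E 0 \<omega> = 0"
    and par: "\<And>k. 0 < a k" "\<And>k. 0 \<le> g k" "\<And>k. 0 \<le> q k" "\<And>k. \<kappa> k \<le> 1" "\<And>k. 0 \<le> \<Theta> k" "0 \<le> C" "0 < c"
    and err: "AE \<omega> in M. \<forall>k. nn_cond_exp M (Fil k) (\<lambda>\<omega>. ennreal (err k \<omega>)) \<omega>
                 \<le> nn_cond_exp M (Fil k) (\<lambda>\<omega>. ennreal (\<Delta> k \<omega>)) \<omega>"
    and VR: "AE \<omega> in M. \<forall>k. nn_cond_exp M (Fil k) (\<lambda>\<omega>. ennreal (\<Delta> k \<omega>)) \<omega>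
                 \<le> ennreal ((1 - \<kappa> k) * (if k = 0 then 0 else \<Delta> (k - 1) \<omega>) + \<Theta> k * E k \<omega> + (\<sigma> k)\<^sup>2)"
    and step: "\<And>k \<omega>. \<omega> \<in> space M \<Longrightarrow>
        V (Suc k) \<omega> + a k * (\<Lambda> * E (Suc k) \<omega>) \<le> (1 + q k) * V k \<omega> + C * a k * err k \<omega>"
    and absorb: "\<And>k. g (Suc k) * \<Theta> (Suc k) \<le> a k * \<Lambda>"
      "\<And>k. g (Suc k) * (1 - \<kappa> (Suc k)) + (C + c) * a k \<le> g k"
    and sums: "summable q" "summable (\<lambda>k. g (Suc k) * (\<sigma> (Suc k))\<^sup>2)"
  shows "AE \<omega> in M. summable (\<lambda>k. a k * err k \<omega>)"
proof -
  interpret prob_space M by fact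
  define D where "D k = (\<integral>\<^sup>+\<omega>. ennreal (\<Delta> k \<omega>) \<partial>M)" for k
  define W where "W k = (\<integral>\<^sup>+\<omega>. ennreal (V k \<omega>) \<partial>M)" for k
  define R where "R k = (\<integral>\<^sup>+\<omega>. ennreal (err k \<omega>) \<partial>M)" for k
  define Q where "Q k = W k + ennreal (g k) * D k" for k
  let ?ce = "\<lambda>k. nn_cond_exp M (Fil k) (\<lambda>\<omega>. ennreal (\<Delta> k \<omega>))"
  note ce_int = nn_integral_nn_cond_exp[OF finite_measure_axioms Fil]
  have ce_meas [measurable]: "?ce k \<in> borel_measurable M" for k
  proof -
    interpret finite_measure_subalgebra M "Fil k"
      using Fil by (simp add: finite_measure_subalgebra_def finite_measure_subalgebra_axioms_def finite_measure_axioms)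
    show ?thesis by simp
  qed
  have RD: "R k \<le> D k" for k
  proof -
    have "(\<integral>\<^sup>+\<omega>. nn_cond_exp M (Fil k) (\<lambda>\<omega>. ennreal (err k \<omega>)) \<omega> \<partial>M) \<le> (\<integral>\<^sup>+\<omega>. ?ce k \<omega> \<partial>M)"
      using err by (intro nn_integral_mono_AE) auto
    then show ?thesis by (simp add: ce_int R_def D_def)
  qed
  have rec: "W (Suc k) + ennreal (g (Suc k)) * D (Suc k)
      \<le> ennreal (g (Suc k) * (1 - \<kappa> (Suc k))) * D k + ennreal (1 + q k) * W k + ennreal (C * a k) * R k
        + ennreal (g (Suc k) * (\<sigma> (Suc k))\<^sup>2)" for k
  proof -
    have coeff: "0 \<le> g (Suc k) * (1 - \<kappa> (Suc k))" "0 \<le> 1 + q k" "0 \<le> C * a k" "0 \<le> g (Suc k) * (\<sigma> (Suc k))\<^sup>2"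
      using par(1)[of k] par(2)[of "Suc k"] par(3)[of k] par(4)[of "Suc k"] par(6) by auto
    have "W (Suc k) + ennreal (g (Suc k)) * D (Suc k)
       = (\<integral>\<^sup>+\<omega>. ennreal (V (Suc k) \<omega>) + ennreal (g (Suc k)) * ?ce (Suc k) \<omega> \<partial>M)"
      by (simp add: nn_integral_add nn_integral_cmult ce_int W_def D_def)
    also have "\<dots> \<le> (\<integral>\<^sup>+\<omega>. ennreal (g (Suc k) * (1 - \<kappa> (Suc k))) * ennreal (\<Delta> k \<omega>) + ennreal (1 + q k) * ennreal (V k \<omega>)
         + ennreal (C * a k) * ennreal (err k \<omega>) + ennreal (g (Suc k) * (\<sigma> (Suc k))\<^sup>2) \<partial>M)"
    proof (rule nn_integral_mono_AE)
      show "AE \<omega> in M. ennreal (V (Suc k) \<omega>) + ennreal (g (Suc k)) * ?ce (Suc k) \<omega>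
        \<le> ennreal (g (Suc k) * (1 - \<kappa> (Suc k))) * ennreal (\<Delta> k \<omega>) + ennreal (1 + q k) * ennreal (V k \<omega>)
         + ennreal (C * a k) * ennreal (err k \<omega>) + ennreal (g (Suc k) * (\<sigma> (Suc k))\<^sup>2)"
        using VR
      proof (rule AE_mp, intro AE_I2 impI)
        fix \<omega> assume \<omega>: "\<omega> \<in> space M"
        assume vr: "\<forall>k. ?ce k \<omega> \<le> ennreal ((1 - \<kappa> k) * (if k = 0 then 0 else \<Delta> (k - 1) \<omega>) + \<Theta> k * E k \<omega> + (\<sigma> k)\<^sup>2)"
        let ?r = "(1 - \<kappa> (Suc k)) * \<Delta> k \<omega> + \<Theta> (Suc k) * E (Suc k) \<omega> + (\<sigma> (Suc k))\<^sup>2"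
        have r0: "0 \<le> ?r"
          using par(4)[of "Suc k"] par(5)[of "Suc k"] nonneg(2)[OF \<omega>, of k] nonneg(4)[of "Suc k" \<omega>] by simp
        have "?ce (Suc k) \<omega> \<le> ennreal ?r" using vr[rule_format, of "Suc k"] by simp
        then have "ennreal (V (Suc k) \<omega>) + ennreal (g (Suc k)) * ?ce (Suc k) \<omega>
            \<le> ennreal (V (Suc k) \<omega>) + ennreal (g (Suc k)) * ennreal ?r"
          by (intro add_mono mult_left_mono) auto
        also have "\<dots> = ennreal (V (Suc k) \<omega> + g (Suc k) * ?r)"
          using r0 par(2)[of "Suc k"] nonneg(1)[OF \<omega>] by (simp add: ennreal_plus ennreal_mult del: ennreal_plus[symmetric])
        also have "V (Suc k) \<omega> + g (Suc k) * ?r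
           \<le> (g (Suc k) * (1 - \<kappa> (Suc k))) * \<Delta> k \<omega> + (1 + q k) * V k \<omega> + (C * a k) * err k \<omega> + g (Suc k) * (\<sigma> (Suc k))\<^sup>2"
        proof -
          have "g (Suc k) * \<Theta> (Suc k) * E (Suc k) \<omega> \<le> a k * \<Lambda> * E (Suc k) \<omega>"
            using absorb(1) nonneg(4) by (intro mult_right_mono) auto
          then show ?thesis using step[OF \<omega>, of k] by (simp add: algebra_simps)
        qed
        also have "ennreal \<dots> = ennreal (g (Suc k) * (1 - \<kappa> (Suc k))) * ennreal (\<Delta> k \<omega>) + ennreal (1 + q k) * ennreal (V k \<omega>)
         + ennreal (C * a k) * ennreal (err k \<omega>) + ennreal (g (Suc k) * (\<sigma> (Suc k))\<^sup>2)"
          using coeff nonneg(1-3)[OF \<omega>, of k] 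
          by (simp add: ennreal_mult[symmetric] del: ennreal_plus add: ennreal_plus[symmetric])
        finally show "ennreal (V (Suc k) \<omega>) + ennreal (g (Suc k)) * ?ce (Suc k) \<omega>
          \<le> ennreal (g (Suc k) * (1 - \<kappa> (Suc k))) * ennreal (\<Delta> k \<omega>) + ennreal (1 + q k) * ennreal (V k \<omega>)
         + ennreal (C * a k) * ennreal (err k \<omega>) + ennreal (g (Suc k) * (\<sigma> (Suc k))\<^sup>2)"
          by (simp add: ennreal_leI)
      qed
    qed
    also have "\<dots> = ennreal (g (Suc k) * (1 - \<kappa> (Suc k))) * D k + ennreal (1 + q k) * W k + ennreal (C * a k) * R k
        + ennreal (g (Suc k) * (\<sigma> (Suc k))\<^sup>2)"
      by (simp add: nn_integral_add nn_integral_cmult D_def W_def R_def emeasure_space_1)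
    finally show ?thesis .
  qed
  have Q_step: "Q (Suc k) + ennreal (c * a k) * D k
      \<le> ennreal (1 + q k) * Q k + ennreal (g (Suc k) * (\<sigma> (Suc k))\<^sup>2)" for k
  proof -
    have coeff: "0 \<le> g (Suc k) * (1 - \<kappa> (Suc k))" "0 \<le> C * a k" "0 \<le> c * a k"
      using par(1)[of k] par(2)[of "Suc k"] par(4)[of "Suc k"] par(6,7) by auto
    let ?s = "ennreal (g (Suc k) * (\<sigma> (Suc k))\<^sup>2)"
    have "Q (Suc k) + ennreal (c * a k) * D k
      \<le> (ennreal (g (Suc k) * (1 - \<kappa> (Suc k))) * D k + ennreal (1 + q k) * W k + ennreal (C * a k) * D k + ?s)
        + ennreal (c * a k) * D k"
      unfolding Q_def
      by (rule add_right_mono, rule order_trans[OF rec]) (intro add_mono mult_left_mono RD order_refl zero_le)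
    also have "\<dots> = ennreal (g (Suc k) * (1 - \<kappa> (Suc k)) + C * a k + c * a k) * D k + ennreal (1 + q k) * W k + ?s"
      using coeff by (simp add: ennreal_plus distrib_right add.assoc add.commute add.left_commute)
    also have "\<dots> \<le> ennreal ((1 + q k) * g k) * D k + ennreal (1 + q k) * W k + ?s"
    proof (intro add_mono mult_right_mono order_refl ennreal_leI zero_le)
      have "0 \<le> q k * g k" using par(2)[of k] par(3)[of k] by simp
      then show "g (Suc k) * (1 - \<kappa> (Suc k)) + C * a k + c * a k \<le> (1 + q k) * g k"
        using absorb(2)[of k] by (simp add: algebra_simps)
    qed
    also have "\<dots> = ennreal (1 + q k) * Q k + ?s"
      using par(2)[of k] par(3)[of k] by (simp add: Q_def ennreal_mult distrib_left mult.assoc add.commute)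
    finally show ?thesis .
  qed
  have "D 0 \<le> ennreal ((\<sigma> 0)\<^sup>2)"
  proof -
    have "D 0 = (\<integral>\<^sup>+\<omega>. ?ce 0 \<omega> \<partial>M)" by (simp add: ce_int D_def)
    also have "\<dots> \<le> (\<integral>\<^sup>+\<omega>. ennreal ((\<sigma> 0)\<^sup>2) \<partial>M)"
    proof (rule nn_integral_mono_AE)
      show "AE \<omega> in M. ?ce 0 \<omega> \<le> ennreal ((\<sigma> 0)\<^sup>2)"
        using VR by (rule AE_mp) (auto simp: start(2) dest: spec[of _ 0])
    qed
    finally show ?thesis by (simp add: emeasure_space_1)
  qed
  then have "D 0 < \<infinity>" by (rule order.strict_trans1) simp
  then have "Q 0 < \<infinity>"
    using start(1) by (simp add: Q_def W_def ennreal_mult_less_top)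
  then have Q_fin: "Q k < \<infinity>" for k
  proof (induction k)
    case (Suc k)
    have "Q (Suc k) \<le> Q (Suc k) + ennreal (c * a k) * D k" by simp
    also have "\<dots> \<le> ennreal (1 + q k) * Q k + ennreal (g (Suc k) * (\<sigma> (Suc k))\<^sup>2)" by (rule Q_step)
    also have "\<dots> < \<infinity>" using Suc by (simp add: ennreal_mult_less_top)
    finally show ?case .
  qed
  have caD_fin: "ennreal (c * a k) * D k < \<infinity>" for k
  proof -
    have "ennreal (c * a k) * D k \<le> Q (Suc k) + ennreal (c * a k) * D k" by simp
    also have "\<dots> \<le> ennreal (1 + q k) * Q k + ennreal (g (Suc k) * (\<sigma> (Suc k))\<^sup>2)" by (rule Q_step)
    also have "\<dots> < \<infinity>" using Q_fin[of k] by (simp add: ennreal_mult_less_top)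
    finally show ?thesis .
  qed
  define v where "v k = enn2real (Q k)" for k
  define d where "d k = enn2real (ennreal (c * a k) * D k)" for k
  have v: "Q k = ennreal (v k)" "0 \<le> v k" for k using Q_fin[of k] by (simp_all add: v_def)
  have d: "ennreal (c * a k) * D k = ennreal (d k)" "0 \<le> d k" for k using caD_fin[of k] by (simp_all add: d_def)
  have "v (Suc k) + d k \<le> (1 + q k) * v k + g (Suc k) * (\<sigma> (Suc k))\<^sup>2" for k
  proof -
    have "ennreal (v (Suc k) + d k) \<le> ennreal ((1 + q k) * v k + g (Suc k) * (\<sigma> (Suc k))\<^sup>2)"
      using Q_step[of k] v d par(2)[of "Suc k"] par(3)[of k] by (simp add: ennreal_mult)
    then show ?thesis
      using v(2)[of k] par(2)[of "Suc k"] par(3)[of k] by (subst (asm) ennreal_le_iff) auto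
  qed
  then have sum_d: "summable d"
    using almost_supermartingale_sequence(2)[of v d "\<lambda>k. g (Suc k) * (\<sigma> (Suc k))\<^sup>2" q] v(2) d(2) par sums by simp
  have "AE \<omega> in M. summable (\<lambda>k. c * a k * err k \<omega>)"
  proof (rule AE_summable_if_expectations_summable[where c = d])
    show "(\<integral>\<^sup>+\<omega>. ennreal (c * a k * err k \<omega>) \<partial>M) \<le> ennreal (d k)" for k
    proof -
      have "(\<integral>\<^sup>+\<omega>. ennreal (c * a k * err k \<omega>) \<partial>M) = (\<integral>\<^sup>+\<omega>. ennreal (c * a k) * ennreal (err k \<omega>) \<partial>M)"
        using par(1)[of k] par(7) nonneg(3) by (intro nn_integral_cong) (simp add: ennreal_mult)
      also have "\<dots> = ennreal (c * a k) * R k" by (simp add: nn_integral_cmult R_def)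
      also have "\<dots> \<le> ennreal (c * a k) * D k" by (intro mult_left_mono RD) simp
      finally show ?thesis by (simp add: d)
    qed
    show "0 \<le> c * a k * err k \<omega>" if "\<omega> \<in> space M" for k \<omega>
      using that nonneg(3) par(1)[of k] par(7) by simp
  qed (use sum_d d in auto)
  then show ?thesis
    using par(7) by (simp add: mult.assoc summable_cmult_iff)
qed

section \<open>Convergence of the method\<close>

text \<open>Demiclosedness of the residual at zero: since the resolvent is nonexpansive, \<open>x\<close> converges along with
  \<open>u\<close>, and closedness of the graph of \<open>T\<close> together with continuity of \<open>F\<close> passes the equation to the limit.\<close>

lemma residual_zero_of_limit:
  fixes x u :: "nat \<Rightarrow> 'a::euclidean_space"
  assumes T: "maximally_co_hypomonotone \<rho> T" and lam: "lam > 0" "2 * \<rho> \<le> lam"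
    and F: "continuous_on UNIV F" and res: "\<And>k. x k \<in> resolvent lam T (u k)"
    and u: "u \<longlonglongrightarrow> ul" and R: "(\<lambda>k. F (x k) + (1 / lam) *\<^sub>R (u k - x k)) \<longlonglongrightarrow> 0"
  obtains xl where "x \<longlonglongrightarrow> xl" "resolvent lam T ul = {xl}" "xl \<in> zer (sum_op F T)"
    "ul \<in> zer (bf_residual F T lam)"
proof -
  have mono: "co_hypomonotone \<rho> T" using T by (simp add: maximally_co_hypomonotone_def)
  have "Cauchy x"
  proof (rule metric_CauchyI)
    fix \<epsilon> :: real assume "0 < \<epsilon>"
    then obtain K where K: "\<forall>m\<ge>K. \<forall>n\<ge>K. dist (u m) (u n) < \<epsilon>"
      using metric_CauchyD[OF LIMSEQ_imp_Cauchy[OF u]] by blast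
    have "dist (x m) (x n) \<le> dist (u m) (u n)" for m n
      using resolvent_nonexpansive[OF mono lam res res] by (simp add: dist_norm)
    then show "\<exists>K. \<forall>m\<ge>K. \<forall>n\<ge>K. dist (x m) (x n) < \<epsilon>"
      using K by (meson order.strict_trans1)
  qed
  then obtain xl where xl: "x \<longlonglongrightarrow> xl" using Cauchy_convergent by (auto simp: convergent_def)
  have sel: "(\<lambda>k. (1 / lam) *\<^sub>R (u k - x k)) \<longlonglongrightarrow> (1 / lam) *\<^sub>R (ul - xl)"
    by (intro tendsto_intros u xl)
  have mem: "(1 / lam) *\<^sub>R (ul - xl) \<in> T xl"
    by (rule maximally_co_hypomonotone_closed[OF T resolvent_selection[OF lam(1) res] xl sel])
  have "isCont F xl" using F by (simp add: continuous_on_eq_continuous_at)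
  then have "(\<lambda>k. F (x k)) \<longlonglongrightarrow> F xl" using xl by (rule isCont_tendsto_compose)
  from tendsto_add[OF this sel] have zero: "F xl + (1 / lam) *\<^sub>R (ul - xl) = 0"
    using R LIMSEQ_unique by blast
  have xl_res: "xl \<in> resolvent lam T ul"
    unfolding resolvent_def using mem lam(1) by (auto intro!: bexI[OF _ mem])
  show thesis
  proof (rule that[OF xl])
    show "resolvent lam T ul = {xl}"
      using xl_res resolvent_unique[OF mono lam] by auto
    show "xl \<in> zer (sum_op F T)"
      unfolding zer_def sum_op_def using mem zero by force
    show "ul \<in> zer (bf_residual F T lam)"
      unfolding zer_def bf_residual_def using xl_res zero by force
  qed
qed

theorem theorem27:
  fixes S :: "(real ^ 'p, 'b) setting"
    and F :: "real ^ 'p \<Rightarrow> real ^ 'p"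
    and T :: "real ^ 'p \<Rightarrow> (real ^ 'p) set"
    and M :: "'w measure" and Fil :: "nat \<Rightarrow> 'w measure"
    and x0 \<xi>0 :: "real ^ 'p"
    and x u v s \<xi> Ft :: "nat \<Rightarrow> 'w \<Rightarrow> real ^ 'p"
    and \<Delta> :: "nat \<Rightarrow> 'w \<Rightarrow> real"
    and \<kappa> \<Theta> \<sigma> \<eta> :: "nat \<Rightarrow> real"
    and t \<Gamma> :: "int \<Rightarrow> real"
    and L Lhat \<rho> lam \<mu> \<nu> r \<beta> \<beta>bar \<Lambda> \<Theta>low \<Gamma>low :: real
  assumes setting: "well_posed S" "F = mean_op S"
    and A1: "zer (sum_op F T) \<noteq> {}"
    and A2: "bounded_variance S"
    and A3: "\<rho> \<ge> 0" "maximally_co_hypomonotone \<rho> T"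
    and A4: "L > 0" "co_coercive_in_mean L S"
    and L: "L * \<rho> < 1" "Lhat > L" "Lhat * \<rho> < 1"
    and \<beta>bar: "\<beta>bar = (lam * (4 - Lhat * lam) - 4 * \<rho>) / (4 * (1 - \<rho> * Lhat))"
    and \<Lambda>: "\<Lambda> = (Lhat - L) / (L * Lhat)"
    and lam: "lam > 0" "2 * \<rho> \<le> lam" "lam < 2 * (1 + sqrt (1 - Lhat * \<rho>)) / Lhat"
    and \<mu>: "0 < \<mu>" "\<mu> < 2 / 3"
    and r: "r \<ge> 2 + 1 / \<mu>"
    and \<nu>: "\<nu> = \<mu> / 2"
    and \<beta>: "0 < \<beta>" "\<beta> < (2 - \<mu>) * \<beta>bar / (2 + \<mu>)"
    and t: "\<forall>k\<ge>-2. t k = \<mu> * (real_of_int k + r)"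
    and \<eta>: "\<forall>k. \<eta> k = 2 * \<beta> * (t (int k) - 1) / (t (int k) - \<nu>)"
    and M: "prob_space M"
    and Fil: "algorithm_filtration M Fil x u Ft \<Delta>"
    and iteration: "\<forall>\<omega>\<in>space M. VFOSA_minus F T lam \<nu> t \<eta> x0 \<xi>0
        (\<lambda>k. Ft k \<omega>) (\<lambda>k. x k \<omega>) (\<lambda>k. u k \<omega>) (\<lambda>k. v k \<omega>) (\<lambda>k. s k \<omega>)"
    and VR: "VR_property M Fil S x Ft \<Delta> \<kappa> \<Theta> \<sigma>"
    and low: "\<Theta>low > 0" "\<Gamma>low > 0"
    and \<Gamma>_init: "\<Gamma> (-1) > 0"
    and \<kappa>: "\<forall>k::nat. \<kappa> k \<ge> 1
        - (\<Gamma> (int k - 1) * t (int k - 2) * (t (int k - 2) - 1))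
            / (\<Gamma> (int k) * t (int k - 1) * (t (int k - 1) - 1))
        + 5 * \<beta> / (\<mu> * \<Gamma> (int k))"
    and \<Gamma>\<Theta>: "\<forall>k::nat. \<Gamma> (int k) \<ge> \<Gamma>low \<and> \<Theta> k \<ge> \<Theta>low \<and> \<Gamma> (int k) * \<Theta> k \<le> \<Lambda>"
    and B: "summable (\<lambda>k. (\<Lambda> / \<beta>) * (t (int k - 1) * (t (int k - 1) - 1) * ((\<sigma> k)\<^sup>2 / \<Theta> k)))"
    and \<xi>: "\<forall>k. \<forall>\<omega>\<in>space M. \<xi> k \<omega> = (1 / lam) *\<^sub>R (u k \<omega> - x k \<omega>)"
  shows "(\<forall>k. \<forall>\<omega>\<in>space M. \<xi> k \<omega> \<in> T (x k \<omega>))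
    \<and> (AE \<omega> in M. summable (\<lambda>k. real (k + 1) * (norm (F (x k \<omega>) + \<xi> k \<omega>))\<^sup>2))
    \<and> (AE \<omega> in M. summable (\<lambda>k. (real (k + 1))\<^sup>2 * (norm (Ft k \<omega> - F (x k \<omega>)))\<^sup>2))
    \<and> (AE \<omega> in M. summable (\<lambda>k. real (k + 1) * (norm (u (k + 1) \<omega> - u k \<omega>))\<^sup>2))
    \<and> (AE \<omega> in M. summable (\<lambda>k. real (k + 1) * (norm (x (k + 1) \<omega> - x k \<omega>))\<^sup>2))
    \<and> (AE \<omega> in M. (\<lambda>k. (real k)\<^sup>2 * (norm (x (k + 1) \<omega> - x k \<omega>))\<^sup>2) \<longlonglongrightarrow> 0)
    \<and> (AE \<omega> in M. (\<lambda>k. (real k)\<^sup>2 * (norm (F (x k \<omega>) + \<xi> k \<omega>))\<^sup>2) \<longlonglongrightarrow> 0)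
    \<and> (\<exists>ustar \<in> borel_measurable M. \<exists>xstar \<in> borel_measurable M.
         (\<forall>\<omega>\<in>space M. ustar \<omega> \<in> zer (bf_residual F T lam)) \<and>
         (AE \<omega> in M. (\<lambda>k. u k \<omega>) \<longlonglongrightarrow> ustar \<omega>) \<and>
         (\<forall>\<omega>\<in>space M. resolvent lam T (ustar \<omega>) = {xstar \<omega>} \<and> xstar \<omega> \<in> zer (sum_op F T)) \<and>
         (AE \<omega> in M. (\<lambda>k. x k \<omega>) \<longlonglongrightarrow> xstar \<omega>))"
proof -
  have mono: "co_hypomonotone \<rho> T" using A3(2) by (simp add: maximally_co_hypomonotone_def)
  have F_cont: "continuous_on UNIV F"
    using mean_op_continuous[OF setting(1) A2 A4] by (simp add: setting(2))
  have \<Lambda>_pos: "0 < \<Lambda>" using A4(1) L(2) by (simp add: \<Lambda>)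
  interpret P: vfosa_parameters \<mu> \<beta> \<beta>bar \<Lambda> r
    using \<mu> \<beta> \<Lambda>_pos r by unfold_locales auto
  interpret prob_space M by (rule M)

  have t_\<tau>: "t (int k) = P.\<tau> k" "t (int k - 1) = P.\<tau> k - \<mu>" "t (int k - 2) = P.\<tau> k - 2 * \<mu>" for k
    using t by (simp_all add: P.\<tau>_def algebra_simps)
  have \<tau>_pos: "0 < P.\<tau> k" for k using P.\<tau>_bounds(1)[of k] \<mu> by simp
  have \<eta>_gain: "\<eta> k = P.gain k" for k
    using \<eta> by (simp add: P.gain_def t_\<tau> \<nu>)

  define R where "R \<omega> k = F (x k \<omega>) + (1 / lam) *\<^sub>R (u k \<omega> - x k \<omega>)" for \<omega> k
  define e where "e \<omega> k = Ft k \<omega> - F (x k \<omega>)" for \<omega> k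
  define E where "E k \<omega> = mean_sq_diff S (x k \<omega>) (x (k - 1) \<omega>)" for k \<omega>

  have res: "x k \<omega> \<in> resolvent lam T (u k \<omega>)" if "\<omega> \<in> space M" for k \<omega>
    using iteration that by (simp add: VFOSA_minus_def)
  have s0: "s 0 \<omega> = u 0 \<omega>" "u 0 \<omega> = x0 + lam *\<^sub>R \<xi>0" if "\<omega> \<in> space M" for \<omega>
    using iteration that by (simp_all add: VFOSA_minus_def)
  have v_eq: "v k \<omega> = u k \<omega> + (1 / P.\<tau> k) *\<^sub>R (s k \<omega> - u k \<omega>)" if "\<omega> \<in> space M" for k \<omega>
  proof -
    have "(P.\<tau> k - 1) / P.\<tau> k = 1 - 1 / P.\<tau> k" using \<tau>_pos[of k] by (simp add: diff_divide_distrib)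
    moreover have "v k \<omega> = ((P.\<tau> k - 1) / P.\<tau> k) *\<^sub>R u k \<omega> + (1 / P.\<tau> k) *\<^sub>R s k \<omega>"
      using iteration that by (simp add: VFOSA_minus_def t_\<tau>)
    ultimately have "v k \<omega> = (1 - 1 / P.\<tau> k) *\<^sub>R u k \<omega> + (1 / P.\<tau> k) *\<^sub>R s k \<omega>" by simp
    then show ?thesis by (simp add: scaleR_diff_left scaleR_diff_right)
  qed
  have u_v: "u (Suc k) \<omega> = v k \<omega> - P.gain k *\<^sub>R (R \<omega> k + e \<omega> k)" if "\<omega> \<in> space M" for k \<omega>
    using iteration that by (simp add: VFOSA_minus_def R_def e_def \<eta>_gain)
  have s_v: "s (Suc k) \<omega> = s k \<omega> - (\<mu> / 2 * P.gain k) *\<^sub>R (R \<omega> k + e \<omega> k)" if "\<omega> \<in> space M" for k \<omega>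
  proof -
    have "s (Suc k) \<omega> = s k \<omega> + \<nu> *\<^sub>R (u (Suc k) \<omega> - v k \<omega>)"
      using iteration that by (simp add: VFOSA_minus_def)
    then show ?thesis using u_v[OF that, of k] by (simp add: \<nu>)
  qed
  note cocoercive = residual_cocoercive[OF setting(1) A2 A4(2,1) L(2,3) mono lam(1,2) \<beta>bar]
  have traj: "vfosa_trajectory \<mu> \<beta> \<beta>bar \<Lambda> r (R \<omega>) (\<lambda>k. u k \<omega>) (\<lambda>k. s k \<omega>) (e \<omega>) (\<lambda>k. E k \<omega>)"
    if \<omega>: "\<omega> \<in> space M" for \<omega>
  proof
    fix k
    show "u (Suc k) \<omega> = u k \<omega> + (1 / P.\<tau> k) *\<^sub>R (s k \<omega> - u k \<omega>) - P.gain k *\<^sub>R (R \<omega> k + e \<omega> k)"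
      using u_v[OF \<omega>] v_eq[OF \<omega>] by simp
    show "s (Suc k) \<omega> = s k \<omega> - (\<mu> / 2 * P.gain k) *\<^sub>R (R \<omega> k + e \<omega> k)"
      by (rule s_v[OF \<omega>])
    show "\<beta>bar * (norm (R \<omega> (Suc k) - R \<omega> k))\<^sup>2 + \<Lambda> * E (Suc k) \<omega> \<le> (R \<omega> (Suc k) - R \<omega> k) \<bullet> (u (Suc k) \<omega> - u k \<omega>)"
      using cocoercive[OF res[OF \<omega>, of "Suc k"] res[OF \<omega>, of k], of "R \<omega> (Suc k)" "R \<omega> k"]
      by (simp add: R_def E_def \<Lambda> setting(2))
    show "0 \<le> E k \<omega>" by (simp add: E_def mean_sq_diff_nonneg)
  qed

  let ?Z = "zer (bf_residual F T lam)"
  have zero: "\<beta>bar * (norm (R \<omega> k))\<^sup>2 \<le> R \<omega> k \<bullet> (u k \<omega> - z)" if \<omega>: "\<omega> \<in> space M" and z: "z \<in> ?Z" for \<omega> k z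
  proof -
    obtain w where w: "w \<in> resolvent lam T z" "0 = F w + (1 / lam) *\<^sub>R (z - w)"
      using z by (auto simp: zer_def bf_residual_def)
    have "\<beta>bar * (norm (R \<omega> k - 0))\<^sup>2 + (Lhat - L) / (L * Lhat) * mean_sq_diff S (x k \<omega>) w \<le> (R \<omega> k - 0) \<bullet> (u k \<omega> - z)"
      by (rule cocoercive[OF res[OF \<omega>] w(1)]) (use w(2) in \<open>simp_all add: R_def setting(2)\<close>)
    moreover have "0 \<le> (Lhat - L) / (L * Lhat) * mean_sq_diff S (x k \<omega>) w"
      using mult_nonneg_nonneg[OF less_imp_le[OF \<Lambda>_pos] mean_sq_diff_nonneg] unfolding \<Lambda> .
    ultimately show ?thesis by simp
  qed

  obtain xz \<zeta>z where xz: "\<zeta>z \<in> T xz" "F xz + \<zeta>z = 0"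
    using A1 by (auto simp: zer_def sum_op_def)
  define z0 where "z0 = xz + lam *\<^sub>R \<zeta>z"
  have xz_res: "xz \<in> resolvent lam T z0" using xz(1) by (auto simp: resolvent_def z0_def)
  have z0: "z0 \<in> ?Z" "resolvent lam T z0 = {xz}" "xz \<in> zer (sum_op F T)"
  proof -
    have "(1 / lam) *\<^sub>R (z0 - xz) = \<zeta>z" using lam(1) by (simp add: z0_def)
    then show "z0 \<in> ?Z" unfolding zer_def bf_residual_def using xz_res xz(2) by force
    show "resolvent lam T z0 = {xz}" using xz_res resolvent_unique[OF mono lam(1,2)] by auto
    show "xz \<in> zer (sum_op F T)" unfolding zer_def sum_op_def using xz by force
  qed

  have sub: "subalgebra M (Fil k)" for k using Fil by (simp add: algorithm_filtration_def)
  have meas_M [measurable]: "x k \<in> borel_measurable M" "u k \<in> borel_measurable M"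
    "Ft k \<in> borel_measurable M" "\<Delta> k \<in> borel_measurable M" for k
    using Fil measurable_from_subalg[OF sub] by (auto simp: algorithm_filtration_def)
  have [measurable]: "F \<in> borel_measurable borel"
    using F_cont by (rule borel_measurable_continuous_onI)
  have R_meas [measurable]: "(\<lambda>\<omega>. R \<omega> k) \<in> borel_measurable M" for k unfolding R_def by measurable
  have e_meas [measurable]: "(\<lambda>\<omega>. e \<omega> k) \<in> borel_measurable M" for k unfolding e_def by measurable
  have s_meas [measurable]: "s k \<in> borel_measurable M" for k
  proof (induction k)
    case 0
    show ?case using s0(1) by (subst measurable_cong[of M _ "u 0"]) auto
  next
    case (Suc k)
    note [measurable] = Suc
    show ?case
      by (subst measurable_cong[OF s_v]) measurable
  qed

  \<comment> \<open>With \<open>g k = \<Gamma>\<^sub>k t\<^sub>k\<^sub>-\<^sub>1 (t\<^sub>k\<^sub>-\<^sub>1 - 1)\<close> the lower bound on \<open>\<kappa>\<close> becomes the absorption condition; its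
    \<open>5 \<beta> / \<mu>\<close> covers the error charge \<open>4 \<beta> / \<mu>\<close> of a step and leaves \<open>\<beta> / \<mu>\<close>.\<close>
  have errors: "AE \<omega> in M. summable (\<lambda>k. P.weight (Suc k) * (norm (e \<omega> k))\<^sup>2)"
  proof (rule variance_reduction_errors_summable[where V = "\<lambda>k \<omega>. P.potential k z0 (R \<omega> k) (u k \<omega>) (s k \<omega>)"
        and \<Delta> = \<Delta> and E = E and Fil = Fil and g = "\<lambda>k. \<Gamma> (int k) * P.weight k" and \<kappa> = \<kappa> and \<Theta> = \<Theta> and \<sigma> = \<sigma>
        and q = "\<lambda>k. P.growth / P.weight (Suc k)" and \<Lambda> = \<Lambda> and C = "4 * \<beta> / \<mu>" and c = "\<beta> / \<mu>"])
    have \<Gamma>_pos: "0 < \<Gamma> (int k)" for k using \<Gamma>\<Theta> low(2) by (meson less_le_trans)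
    have \<Theta>_pos: "0 < \<Theta> k" for k using \<Gamma>\<Theta> low(1) by (meson less_le_trans)
    show "prob_space M" by (rule M)
    show "subalgebra M (Fil k)" for k by (rule sub)
    show "(\<lambda>\<omega>. P.potential k z0 (R \<omega> k) (u k \<omega>) (s k \<omega>)) \<in> borel_measurable M" for k
      unfolding P.potential_def by measurable
    show "\<Delta> k \<in> borel_measurable M" for k by measurable
    show "(\<lambda>\<omega>. (norm (e \<omega> k))\<^sup>2) \<in> borel_measurable M" for k by measurable
    show "0 \<le> P.potential k z0 (R \<omega> k) (u k \<omega>) (s k \<omega>)" if "\<omega> \<in> space M" for k \<omega>
      by (rule P.potential_nonneg[OF zero[OF that z0(1)]])
    show "0 \<le> \<Delta> k \<omega>" if "\<omega> \<in> space M" for k \<omega> using VR that by (simp add: VR_property_def)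
    show "0 \<le> E k \<omega>" for k \<omega> by (simp add: E_def mean_sq_diff_nonneg)
    show "E 0 \<omega> = 0" for \<omega> by (simp add: E_def mean_sq_diff_refl)
    show "(\<integral>\<^sup>+\<omega>. ennreal (P.potential 0 z0 (R \<omega> 0) (u 0 \<omega>) (s 0 \<omega>)) \<partial>M) < \<infinity>"
    proof -
      let ?u0 = "x0 + lam *\<^sub>R \<xi>0"
      let ?p = "P.potential 0 z0 (F x0 + (1 / lam) *\<^sub>R (?u0 - x0)) ?u0 ?u0"
      have "P.potential 0 z0 (R \<omega> 0) (u 0 \<omega>) (s 0 \<omega>) = ?p" if \<omega>: "\<omega> \<in> space M" for \<omega>
      proof -
        have "\<xi>0 \<in> T x0" using iteration \<omega> by (simp add: VFOSA_minus_def)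
        then have "x0 \<in> resolvent lam T (u 0 \<omega>)" using s0(2)[OF \<omega>] by (auto simp: resolvent_def)
        then have "x 0 \<omega> = x0" using resolvent_unique[OF mono lam(1,2) res[OF \<omega>]] by blast
        then show ?thesis using s0[OF \<omega>] by (simp add: R_def)
      qed
      then have "(\<integral>\<^sup>+\<omega>. ennreal (P.potential 0 z0 (R \<omega> 0) (u 0 \<omega>) (s 0 \<omega>)) \<partial>M) = (\<integral>\<^sup>+\<omega>. ennreal ?p \<partial>M)"
        by (intro nn_integral_cong) simp
      then show ?thesis by (simp add: emeasure_space_1)
    qed
    show "0 < P.weight (Suc k)" for k by (rule P.weight_pos)
    show "0 \<le> \<Gamma> (int k) * P.weight k" for k using \<Gamma>_pos[of k] P.weight_pos[of k] by simp
    show "0 \<le> P.growth / P.weight (Suc k)" for k using P.growth_nonneg P.weight_pos[of "Suc k"] by simp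
    show "\<kappa> k \<le> 1" "0 \<le> \<Theta> k" for k using VR by (auto simp: VR_property_def)
    show "0 \<le> 4 * \<beta> / \<mu>" "0 < \<beta> / \<mu>" using \<mu> \<beta> by auto
    show "AE \<omega> in M. \<forall>k. nn_cond_exp M (Fil k) (\<lambda>\<omega>. ennreal ((norm (e \<omega> k))\<^sup>2)) \<omega>
         \<le> nn_cond_exp M (Fil k) (\<lambda>\<omega>. ennreal (\<Delta> k \<omega>)) \<omega>"
      using VR unfolding VR_property_def e_def setting(2) by (auto elim: AE_mp)
    show "AE \<omega> in M. \<forall>k. nn_cond_exp M (Fil k) (\<lambda>\<omega>. ennreal (\<Delta> k \<omega>)) \<omega>
         \<le> ennreal ((1 - \<kappa> k) * (if k = 0 then 0 else \<Delta> (k - 1) \<omega>) + \<Theta> k * E k \<omega> + (\<sigma> k)\<^sup>2)"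
      using VR unfolding VR_property_def E_def by (auto elim: AE_mp)
    show "P.potential (Suc k) z0 (R \<omega> (Suc k)) (u (Suc k) \<omega>) (s (Suc k) \<omega>) + P.weight (Suc k) * (\<Lambda> * E (Suc k) \<omega>)
      \<le> (1 + P.growth / P.weight (Suc k)) * P.potential k z0 (R \<omega> k) (u k \<omega>) (s k \<omega>)
        + 4 * \<beta> / \<mu> * P.weight (Suc k) * (norm (e \<omega> k))\<^sup>2" if \<omega>: "\<omega> \<in> space M" for k \<omega>
    proof -
      have "0 \<le> (2 - 3 * \<mu>) * \<beta> * P.\<tau> k * (norm (R \<omega> k))\<^sup>2"
        "0 \<le> P.margin * P.weight (Suc k) * (norm (R \<omega> (Suc k) - R \<omega> k))\<^sup>2"
        using \<mu> \<beta>(1) \<tau>_pos[of k] P.margin_pos P.weight_pos[of "Suc k"] by auto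
      then show ?thesis
        using vfosa_trajectory.potential_step[OF traj[OF \<omega>] zero[OF \<omega> z0(1)]] by (smt (verit))
    qed
    show "\<Gamma> (int (Suc k)) * P.weight (Suc k) * \<Theta> (Suc k) \<le> P.weight (Suc k) * \<Lambda>" for k
    proof -
      have "P.weight (Suc k) * (\<Gamma> (int (Suc k)) * \<Theta> (Suc k)) \<le> P.weight (Suc k) * \<Lambda>"
        using \<Gamma>\<Theta>[rule_format, of "Suc k"] P.weight_pos[of "Suc k"] by (intro mult_left_mono) auto
      then show ?thesis by (simp add: mult.commute mult.left_commute mult.assoc)
    qed
    show "\<Gamma> (int (Suc k)) * P.weight (Suc k) * (1 - \<kappa> (Suc k)) + (4 * \<beta> / \<mu> + \<beta> / \<mu>) * P.weight (Suc k)
        \<le> \<Gamma> (int k) * P.weight k" for k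
    proof -
      define G where "G = \<Gamma> (int (Suc k))"
      define W where "W = P.weight (Suc k)"
      have pos: "0 < G" "0 < W" using \<Gamma>_pos[of "Suc k"] P.weight_pos[of "Suc k"] by (auto simp: G_def W_def)
      have idx: "int (Suc k) - 1 = int k" "t (int (Suc k) - 2) = P.\<tau> k - \<mu>" "t (int k) = P.\<tau> k"
        using t_\<tau>(1,2)[of k] t_\<tau>(3)[of "Suc k"] by (auto simp: P.\<tau>_Suc)
      have "1 - \<Gamma> (int k) * P.weight k / (G * W) + 5 * \<beta> / (\<mu> * G) \<le> \<kappa> (Suc k)"
        using \<kappa>[rule_format, of "Suc k"] unfolding idx P.weight_Suc W_def P.weight_def[of k] G_def
        by (simp add: mult.assoc)
      then have "G * W * (1 - \<kappa> (Suc k)) \<le> G * W * (\<Gamma> (int k) * P.weight k / (G * W) - 5 * \<beta> / (\<mu> * G))"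
        using pos by (intro mult_left_mono) auto
      also have "\<dots> = \<Gamma> (int k) * P.weight k - 5 * \<beta> / \<mu> * W"
        using pos \<mu> by (simp add: right_diff_distrib)
      finally show ?thesis unfolding G_def W_def by (simp add: add_divide_distrib[symmetric])
    qed
    show "summable (\<lambda>k. P.growth / P.weight (Suc k))" by (rule P.summable_inverse_weight)
    show "summable (\<lambda>k. \<Gamma> (int (Suc k)) * P.weight (Suc k) * (\<sigma> (Suc k))\<^sup>2)"
    proof (rule summable_comparison_test'[where N = 0])
      have w: "t (int k - 1) * (t (int k - 1) - 1) = P.weight k" for k by (simp add: t_\<tau> P.weight_def)
      have "summable (\<lambda>k. \<beta> * ((\<Lambda> / \<beta>) * (P.weight k * ((\<sigma> k)\<^sup>2 / \<Theta> k))))"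
        using B unfolding w by (rule summable_mult)
      then have "summable (\<lambda>k. \<Lambda> * (P.weight k * ((\<sigma> k)\<^sup>2 / \<Theta> k)))" using \<beta>(1) by simp
      then show "summable (\<lambda>k. \<Lambda> * (P.weight (Suc k) * ((\<sigma> (Suc k))\<^sup>2 / \<Theta> (Suc k))))"
        by (subst summable_Suc_iff)
      fix k
      have "\<Gamma> (int (Suc k)) \<le> \<Lambda> / \<Theta> (Suc k)"
        using \<Gamma>\<Theta>[rule_format, of "Suc k"] \<Theta>_pos[of "Suc k"] by (simp add: pos_le_divide_eq)
      then have "\<Gamma> (int (Suc k)) * (P.weight (Suc k) * (\<sigma> (Suc k))\<^sup>2) \<le> \<Lambda> / \<Theta> (Suc k) * (P.weight (Suc k) * (\<sigma> (Suc k))\<^sup>2)"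
        using P.weight_pos[of "Suc k"] by (intro mult_right_mono) auto
      moreover have "0 \<le> \<Gamma> (int (Suc k)) * (P.weight (Suc k) * (\<sigma> (Suc k))\<^sup>2)"
        using P.weight_pos[of "Suc k"] \<Gamma>_pos[of "Suc k"] by simp
      ultimately show "norm (\<Gamma> (int (Suc k)) * P.weight (Suc k) * (\<sigma> (Suc k))\<^sup>2)
          \<le> \<Lambda> * (P.weight (Suc k) * ((\<sigma> (Suc k))\<^sup>2 / \<Theta> (Suc k)))"
        by (simp add: mult.assoc)
    qed
  qed simp

  have conv: "vfosa_convergent_trajectory \<mu> \<beta> \<beta>bar \<Lambda> r (R \<omega>) (\<lambda>k. u k \<omega>) (\<lambda>k. s k \<omega>) (e \<omega>) (\<lambda>k. E k \<omega>) z"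
    if "\<omega> \<in> space M" "summable (\<lambda>k. P.weight (Suc k) * (norm (e \<omega> k))\<^sup>2)" "z \<in> ?Z" for \<omega> z
    using traj[OF that(1)] zero[OF that(1,3)] that(2)
    by (simp add: vfosa_convergent_trajectory_def vfosa_convergent_trajectory_axioms_def)

  define good where "good \<omega> \<longleftrightarrow>
      summable (\<lambda>k. real (k + 1) * (norm (F (x k \<omega>) + \<xi> k \<omega>))\<^sup>2)
    \<and> summable (\<lambda>k. (real (k + 1))\<^sup>2 * (norm (Ft k \<omega> - F (x k \<omega>)))\<^sup>2)
    \<and> summable (\<lambda>k. real (k + 1) * (norm (u (k + 1) \<omega> - u k \<omega>))\<^sup>2)
    \<and> summable (\<lambda>k. real (k + 1) * (norm (x (k + 1) \<omega> - x k \<omega>))\<^sup>2)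
    \<and> (\<lambda>k. (real k)\<^sup>2 * (norm (x (k + 1) \<omega> - x k \<omega>))\<^sup>2) \<longlonglongrightarrow> 0
    \<and> (\<lambda>k. (real k)\<^sup>2 * (norm (F (x k \<omega>) + \<xi> k \<omega>))\<^sup>2) \<longlonglongrightarrow> 0
    \<and> (\<exists>ul\<in>?Z. \<exists>xl\<in>zer (sum_op F T). (\<lambda>k. u k \<omega>) \<longlonglongrightarrow> ul \<and> (\<lambda>k. x k \<omega>) \<longlonglongrightarrow> xl \<and> resolvent lam T ul = {xl})" for \<omega>
  \<comment> \<open>From here on the argument is deterministic, one realisation at a time; the exceptional set is the same
    for all zeros \<open>z\<close>.\<close>
  have good_path: "good \<omega>"
    if \<omega>: "\<omega> \<in> space M" and err: "summable (\<lambda>k. P.weight (Suc k) * (norm (e \<omega> k))\<^sup>2)" for \<omega>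
  proof -
    interpret C: vfosa_convergent_trajectory \<mu> \<beta> \<beta>bar \<Lambda> r "R \<omega>" "\<lambda>k. u k \<omega>" "\<lambda>k. s k \<omega>" "e \<omega>" "\<lambda>k. E k \<omega>" z0
      by (rule conv[OF \<omega> err z0(1)])
    have R_\<xi>: "F (x k \<omega>) + \<xi> k \<omega> = R \<omega> k" for k using \<xi> \<omega> by (simp add: R_def)
    have dx: "norm (x (Suc k) \<omega> - x k \<omega>) \<le> norm (u (Suc k) \<omega> - u k \<omega>)" for k
      by (rule resolvent_nonexpansive[OF mono lam(1,2) res[OF \<omega>] res[OF \<omega>]])
    have sum_u: "summable (\<lambda>k. (real k + 1) * (norm (u (Suc k) \<omega> - u k \<omega>))\<^sup>2)"
      by (rule C.summable_linear_weight[OF C.summable_\<tau>_increment]) simp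
    have sum_x: "summable (\<lambda>k. (real k + 1) * (norm (x (Suc k) \<omega> - x k \<omega>))\<^sup>2)"
      by (rule summable_comparison_test'[OF sum_u, of 0]) (auto intro!: mult_left_mono power_mono dx)
    have rate_x: "(\<lambda>k. (real k)\<^sup>2 * (norm (x (Suc k) \<omega> - x k \<omega>))\<^sup>2) \<longlonglongrightarrow> 0"
      by (rule Lim_null_comparison[OF always_eventually C.increment_rate])
         (auto intro!: mult_mono power_mono dx)
    have rate_R: "(\<lambda>k. (real k)\<^sup>2 * (norm (R \<omega> k))\<^sup>2) \<longlonglongrightarrow> 0"
      by (rule Lim_null_comparison[OF always_eventually C.residual_rate])
         (auto intro!: mult_mono power_mono)
    have R_lim: "R \<omega> \<longlonglongrightarrow> 0"
    proof -
      have "(\<lambda>k. (norm (R \<omega> k))\<^sup>2) \<longlonglongrightarrow> 0"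
      proof (rule Lim_null_comparison[OF always_eventually C.residual_rate], rule allI)
        fix k
        have "1 * (norm (R \<omega> k))\<^sup>2 \<le> (real k + 1)\<^sup>2 * (norm (R \<omega> k))\<^sup>2"
          by (intro mult_right_mono one_le_power) auto
        then show "norm ((norm (R \<omega> k))\<^sup>2) \<le> (real k + 1)\<^sup>2 * (norm (R \<omega> k))\<^sup>2" by simp
      qed
      then have "(\<lambda>k. sqrt ((norm (R \<omega> k))\<^sup>2)) \<longlonglongrightarrow> sqrt 0" by (rule tendsto_real_sqrt)
      then show ?thesis by (simp add: tendsto_norm_zero_iff)
    qed
    have "\<exists>ul\<in>?Z. (\<lambda>k. u k \<omega>) \<longlonglongrightarrow> ul"
    proof (rule Opial_finite_dimensional)
      show "?Z \<noteq> {}" using z0(1) by blast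
      show "convergent (\<lambda>k. norm (u k \<omega> - z))" if "z \<in> ?Z" for z
        by (rule vfosa_convergent_trajectory.distance_converges[OF conv[OF \<omega> err that]])
      show "l \<in> ?Z" if rr: "strict_mono \<phi>" "((\<lambda>k. u k \<omega>) \<circ> \<phi>) \<longlonglongrightarrow> l" for \<phi> l
      proof -
        have "(\<lambda>k. F (x (\<phi> k) \<omega>) + (1 / lam) *\<^sub>R (((\<lambda>k. u k \<omega>) \<circ> \<phi>) k - x (\<phi> k) \<omega>)) \<longlonglongrightarrow> 0"
          using LIMSEQ_subseq_LIMSEQ[OF R_lim rr(1)] by (simp add: R_def o_def)
        then show ?thesis
          using residual_zero_of_limit[OF A3(2) lam(1,2) F_cont _ rr(2), of "\<lambda>k. x (\<phi> k) \<omega>"] res[OF \<omega>]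
          by (metis comp_apply)
      qed
    qed
    then obtain ul where ul: "ul \<in> ?Z" "(\<lambda>k. u k \<omega>) \<longlonglongrightarrow> ul" by blast
    obtain xl where xl: "(\<lambda>k. x k \<omega>) \<longlonglongrightarrow> xl" "resolvent lam T ul = {xl}" "xl \<in> zer (sum_op F T)"
      using residual_zero_of_limit[OF A3(2) lam(1,2) F_cont res[OF \<omega>] ul(2)] R_lim unfolding R_def by blast
    show ?thesis
      unfolding good_def R_\<xi>
    proof (intro conjI)
      show "summable (\<lambda>k. real (k + 1) * (norm (R \<omega> k))\<^sup>2)"
        using C.summable_linear_weight[OF C.summable_\<tau>_residual] by (simp add: add.commute)
      show "summable (\<lambda>k. (real (k + 1))\<^sup>2 * (norm (Ft k \<omega> - F (x k \<omega>)))\<^sup>2)"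
        using C.summable_squared_error by (simp add: e_def add.commute)
      show "\<exists>ul\<in>?Z. \<exists>xl\<in>zer (sum_op F T). (\<lambda>k. u k \<omega>) \<longlonglongrightarrow> ul \<and> (\<lambda>k. x k \<omega>) \<longlonglongrightarrow> xl \<and> resolvent lam T ul = {xl}"
        using ul xl by blast
    qed (use sum_u sum_x rate_x rate_R in \<open>simp_all add: add.commute\<close>)
  qed
  have AE_good: "AE \<omega> in M. good \<omega>"
    using errors by (rule AE_mp) (auto intro: good_path)

  obtain N where N: "{\<omega> \<in> space M. \<not> good \<omega>} \<subseteq> N" "emeasure M N = 0" "N \<in> sets M"
    using AE_good by (rule AE_E)
  have AE_N: "AE \<omega> in M. \<omega> \<notin> N" using N by (intro AE_not_in) auto
  \<comment> \<open>On the exceptional null set the limits are replaced by a fixed zero, so that the zero properties hold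
    everywhere.\<close>
  define ustar where "ustar \<omega> = (if \<omega> \<in> N then z0 else lim (\<lambda>k. u k \<omega>))" for \<omega>
  define xstar where "xstar \<omega> = (if \<omega> \<in> N then xz else lim (\<lambda>k. x k \<omega>))" for \<omega>
  have limits: "ustar \<omega> \<in> ?Z \<and> xstar \<omega> \<in> zer (sum_op F T) \<and> resolvent lam T (ustar \<omega>) = {xstar \<omega>}
      \<and> (\<omega> \<notin> N \<longrightarrow> (\<lambda>k. u k \<omega>) \<longlonglongrightarrow> ustar \<omega> \<and> (\<lambda>k. x k \<omega>) \<longlonglongrightarrow> xstar \<omega>)" if "\<omega> \<in> space M" for \<omega>
  proof (cases "\<omega> \<in> N")
    case True
    then show ?thesis using z0 by (simp add: ustar_def xstar_def)
  next
    case False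
    then have "good \<omega>" using N(1) that by blast
    then obtain ul xl where "ul \<in> ?Z" "xl \<in> zer (sum_op F T)" "(\<lambda>k. u k \<omega>) \<longlonglongrightarrow> ul" "(\<lambda>k. x k \<omega>) \<longlonglongrightarrow> xl"
      "resolvent lam T ul = {xl}"
      unfolding good_def by blast
    then show ?thesis using False by (simp add: ustar_def xstar_def limI)
  qed
  note [measurable] = N(3)
  have "ustar \<in> borel_measurable M" "xstar \<in> borel_measurable M"
    unfolding ustar_def[abs_def] xstar_def[abs_def] by measurable
  moreover have "AE \<omega> in M. (\<lambda>k. u k \<omega>) \<longlonglongrightarrow> ustar \<omega>" "AE \<omega> in M. (\<lambda>k. x k \<omega>) \<longlonglongrightarrow> xstar \<omega>"
    using AE_N AE_space by (eventually_elim, use limits in blast)+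
  ultimately have "\<exists>ustar \<in> borel_measurable M. \<exists>xstar \<in> borel_measurable M.
         (\<forall>\<omega>\<in>space M. ustar \<omega> \<in> ?Z) \<and>
         (AE \<omega> in M. (\<lambda>k. u k \<omega>) \<longlonglongrightarrow> ustar \<omega>) \<and>
         (\<forall>\<omega>\<in>space M. resolvent lam T (ustar \<omega>) = {xstar \<omega>} \<and> xstar \<omega> \<in> zer (sum_op F T)) \<and>
         (AE \<omega> in M. (\<lambda>k. x k \<omega>) \<longlonglongrightarrow> xstar \<omega>)"
    using limits by (intro bexI[of _ ustar] bexI[of _ xstar]) auto
  moreover have "\<forall>k. \<forall>\<omega>\<in>space M. \<xi> k \<omega> \<in> T (x k \<omega>)"
    using \<xi> resolvent_selection[OF lam(1) res] by simp
  moreover note AE_good[unfolded good_def]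
  ultimately show ?thesis by (auto elim: AE_mp)
qed

end
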